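(* For every $p \in [6,\infty]$ there exists a sequence $(\psi_n)_{n\ge 1}$ of real-valued eigenfunctions of the Laplacian on the 2-sphere $S^2$, with eigenvalues $\lambda_n \to \infty$ as $n \to \infty$, such that the following limit exists and satisfies $$\lim_{n\to\infty} \frac{\|\psi_{n,+}\|_p}{\|\psi_{n,-}\|_p} > 1.$$
   Context: $S^2$ is the 2-sphere with its standard round metric. An eigenfunction of the Laplacian with eigenvalue $\lambda$ is a not identically zero smooth function $\psi$ with $-\Delta \psi = \lambda \psi$, where $\Delta$ is the Laplace–Beltrami operator. For a real-valued function $\psi$, $\psi_+ = \max(\psi,0)$ and $\psi_- = \max(-\psi,0)$ denote its positive and negative parts (the latter taken in absolute value), and $\psi_{n,\pm} = (\psi_n)_\pm$. The norm $\|\cdot\|_p$ is the $L^p$ norm with respect to the Riemannian surface measure (the essential supremum norm when $p=\infty$). *)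

theory Defs
  imports "HOL-Probability.Probability"
begin

text \<open>
  The sphere is the unit sphere of \<open>real ^ 3\<close> with the induced metric. Functions and vector fields
  on it are total functions on \<open>real ^ 3\<close>; every notion below depends only on their values on
  \<open>S2\<close>.
\<close>

abbreviation S2 :: "(real ^ 3) set" where
  "S2 \<equiv> sphere 0 1"

primrec Ck_on :: "nat \<Rightarrow> ('a::euclidean_space \<Rightarrow> 'b::real_normed_vector) \<Rightarrow> 'a set \<Rightarrow> bool" where
  "Ck_on 0 f U \<longleftrightarrow> continuous_on U f"
| "Ck_on (Suc k) f U \<longleftrightarrow>
     (\<forall>x\<in>U. f differentiable (at x)) \<and> (\<forall>v. Ck_on k (\<lambda>x. frechet_derivative f (at x) v) U)"

text \<open>Smoothness on the embedded submanifold \<open>S2\<close>: locally the restriction of a smooth function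
  on an open subset of the ambient space.\<close>

definition smooth_on_S2 :: "(real ^ 3 \<Rightarrow> real) \<Rightarrow> bool" where
  "smooth_on_S2 f \<longleftrightarrow>
     (\<forall>x\<in>S2. \<exists>U F. open U \<and> x \<in> U \<and> (\<forall>k. Ck_on k F U) \<and> (\<forall>y \<in> U \<inter> S2. F y = f y))"

text \<open>As \<open>sgn y = y /\<^sub>R norm y\<close> retracts the punctured space onto \<open>S2\<close>, and its derivative at
  \<open>x \<in> S2\<close> is the orthogonal projection onto the tangent plane \<open>{v. v \<bullet> x = 0}\<close>, the following is,
  for tangent \<open>v\<close>, the differential at \<open>x\<close> of \<open>f\<close> restricted to \<open>S2\<close>.\<close>

definition S2_differential ::
    "(real ^ 3 \<Rightarrow> 'b::real_normed_vector) \<Rightarrow> real ^ 3 \<Rightarrow> real ^ 3 \<Rightarrow> 'b" where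
  "S2_differential f x v = frechet_derivative (\<lambda>y. f (sgn y)) (at x) v"

definition S2_grad :: "(real ^ 3 \<Rightarrow> real) \<Rightarrow> real ^ 3 \<Rightarrow> real ^ 3" where
  "S2_grad f x =
     (THE g. g \<bullet> x = 0 \<and> (\<forall>v. v \<bullet> x = 0 \<longrightarrow> g \<bullet> v = S2_differential f x v))"

definition tangent_proj :: "real ^ 3 \<Rightarrow> real ^ 3 \<Rightarrow> real ^ 3" where
  "tangent_proj x v = v - (v \<bullet> x) *\<^sub>R x"

text \<open>The Levi-Civita connection of the induced metric is the tangential part of the ambient
  derivative.\<close>

definition S2_covariant_deriv :: "(real ^ 3 \<Rightarrow> real ^ 3) \<Rightarrow> real ^ 3 \<Rightarrow> real ^ 3 \<Rightarrow> real ^ 3" where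
  "S2_covariant_deriv X x v = tangent_proj x (S2_differential X x v)"

text \<open>The trace of an endomorphism of the tangent plane at \<open>x\<close> equals the trace, over the ambient
  space, of its composition with \<open>tangent_proj x\<close>.\<close>

definition S2_div :: "(real ^ 3 \<Rightarrow> real ^ 3) \<Rightarrow> real ^ 3 \<Rightarrow> real" where
  "S2_div X x = (\<Sum>b\<in>Basis. S2_covariant_deriv X x (tangent_proj x b) \<bullet> b)"

definition S2_laplacian :: "(real ^ 3 \<Rightarrow> real) \<Rightarrow> real ^ 3 \<Rightarrow> real" where
  "S2_laplacian f = S2_div (S2_grad f)"

definition S2_eigenfunction :: "(real ^ 3 \<Rightarrow> real) \<Rightarrow> real \<Rightarrow> bool" where
  "S2_eigenfunction \<psi> l \<longleftrightarrow>
     smooth_on_S2 \<psi> \<and> (\<exists>x\<in>S2. \<psi> x \<noteq> 0) \<and> (\<forall>x\<in>S2. - S2_laplacian \<psi> x = l * \<psi> x)"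

text \<open>Polar angle and azimuth. On \<open>{0<..<pi} \<times> {0<..<2 * pi}\<close> this parametrizes all of \<open>S2\<close> except
  a half great circle, which is a null set.\<close>

definition S2_param :: "real \<times> real \<Rightarrow> real ^ 3" where
  "S2_param = (\<lambda>(\<theta>, \<phi>). vector [sin \<theta> * cos \<phi>, sin \<theta> * sin \<phi>, cos \<theta>])"

text \<open>The Riemannian area density: square root of the determinant of the metric in the coordinates
  \<open>(\<theta>, \<phi>)\<close>.\<close>

definition S2_area_density :: "real \<times> real \<Rightarrow> real" where
  "S2_area_density u =
     (let d1 = frechet_derivative S2_param (at u) (1, 0);
          d2 = frechet_derivative S2_param (at u) (0, 1)
      in sqrt ((d1 \<bullet> d1) * (d2 \<bullet> d2) - (d1 \<bullet> d2)\<^sup>2))"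

lemma S2_area_density_eq: "S2_area_density (\<theta>, \<phi>) = \<bar>sin \<theta>\<bar>"
proof -
  define e where "e = (\<lambda>i. axis i 1 :: real ^ 3)"
  have param: "S2_param = (\<lambda>u. (sin (fst u) * cos (snd u)) *\<^sub>R e 1
      + (sin (fst u) * sin (snd u)) *\<^sub>R e 2 + cos (fst u) *\<^sub>R e 3)"
    by (rule ext) (auto simp: S2_param_def e_def vec_eq_iff forall_3 axis_def split: prod.splits)
  have "(S2_param has_derivative (\<lambda>h.
      (cos \<theta> * fst h * cos \<phi> - sin \<theta> * (sin \<phi> * snd h)) *\<^sub>R e 1
      + (cos \<theta> * fst h * sin \<phi> + sin \<theta> * (cos \<phi> * snd h)) *\<^sub>R e 2
      + (- sin \<theta> * fst h) *\<^sub>R e 3)) (at (\<theta>, \<phi>))"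
    unfolding param by (auto intro!: derivative_eq_intros simp: algebra_simps)
  note D = frechet_derivative_at[OF this, symmetric]
  define d1 where "d1 = frechet_derivative S2_param (at (\<theta>, \<phi>)) (1, 0)"
  define d2 where "d2 = frechet_derivative S2_param (at (\<theta>, \<phi>)) (0, 1)"
  have "d1 \<bullet> d1 = (cos \<theta>)\<^sup>2 * ((sin \<phi>)\<^sup>2 + (cos \<phi>)\<^sup>2) + (sin \<theta>)\<^sup>2"
    unfolding d1_def D by (simp add: inner_vec_def sum_3 e_def axis_def power2_eq_square algebra_simps
        del: sin_cos_squared_add sin_cos_squared_add2 sin_cos_squared_add3)
  moreover have "d2 \<bullet> d2 = (sin \<theta>)\<^sup>2 * ((sin \<phi>)\<^sup>2 + (cos \<phi>)\<^sup>2)"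
    unfolding d2_def D by (simp add: inner_vec_def sum_3 e_def axis_def power2_eq_square algebra_simps
        del: sin_cos_squared_add sin_cos_squared_add2 sin_cos_squared_add3)
  moreover have "d1 \<bullet> d2 = 0"
    unfolding d1_def d2_def D by (simp add: inner_vec_def sum_3 e_def axis_def)
  ultimately show ?thesis
    by (simp add: S2_area_density_def Let_def d1_def[symmetric] d2_def[symmetric])
qed

definition S2_measure :: "(real ^ 3) measure" where
  "S2_measure =
     distr (density lborel
              (\<lambda>u. ennreal (S2_area_density u) * indicator ({0<..<pi} \<times> {0<..<2 * pi}) u))
           (restrict_space borel S2) S2_param"

text \<open>For \<open>p < \<infinity>\<close> the value is meaningful only if \<open>\<bar>f\<bar>\<close> to the power \<open>p\<close> is integrable, and for
  \<open>p = \<infinity>\<close> only if \<open>f\<close> is measurable and essentially bounded. Both hold for every function continuous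
  on \<open>S2\<close> when \<open>M = S2_measure\<close>.\<close>

definition Lp_norm :: "ennreal \<Rightarrow> 'a measure \<Rightarrow> ('a \<Rightarrow> real) \<Rightarrow> real" where
  "Lp_norm p M f =
     (if p = \<infinity> then real_of_ereal (esssup M (\<lambda>x. ereal \<bar>f x\<bar>))
      else (\<integral>x. \<bar>f x\<bar> powr enn2real p \<partial>M) powr (1 / enn2real p))"

end

theory Submission
  imports Defs "HOL-Computational_Algebra.Polynomial"
begin

text \<open>
  The zonal harmonics of even degree \<open>n = 2 m\<close> do the job. By the hat-box theorem their \<open>L\<^sup>p\<close> norms
  are those of the Legendre polynomial \<open>P\<close> of degree \<open>n\<close> on \<open>[-1, 1]\<close>, or by evenness on \<open>[0, 1]\<close>. Put
  \<open>\<lambda> = n (n + 1)\<close> and \<open>t = \<lambda> (1 - x) / 2\<close>. The expansion of \<open>P\<close> at \<open>x = 1\<close> alternates, whence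
  \<open>1 - t \<le> P \<le> 1\<close> for \<open>t \<le> 1\<close> and \<open>P \<le> -1/4\<close> for \<open>3 \<le> t \<le> 4\<close>. For \<open>t \<ge> 1\<close> Sonin's monotonicity
  gives \<open>P\<^sup>2 \<le> P(0)\<^sup>2 / (1 - x\<^sup>2)\<^sup>1\<^sup>/\<^sup>2\<close> with \<open>P(0)\<^sup>2 \<le> 1 / (3 m + 1)\<close>. For \<open>p \<ge> 6\<close> the integral of
  \<open>\<bar>P\<bar>\<^sup>p\<close> over \<open>t \<ge> 1\<close>, bounded through its sixth power, is smaller than the contribution of the main
  lobe by a fixed factor. So the ratio of the norms stays in a compact subinterval of \<open>(1, \<infinity>)\<close>, and
  a subsequence of it converges.
\<close>

subsection \<open>Legendre polynomials\<close>

text \<open>Bonnet's recurrence, so that values, parity and derivative identities come by plain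
  induction.\<close>

fun legendre :: "nat \<Rightarrow> real poly" where
  "legendre 0 = 1"
| "legendre (Suc 0) = [:0, 1:]"
| "legendre (Suc (Suc n)) = smult (1 / real (n + 2))
     (smult (real (2 * n + 3)) ([:0, 1:] * legendre (Suc n)) - smult (real (n + 1)) (legendre n))"

lemma legendre_recurrence:
  "real (n + 2) * poly (legendre (Suc (Suc n))) x
     = real (2 * n + 3) * x * poly (legendre (Suc n)) x - real (n + 1) * poly (legendre n) x"
  by (simp add: field_simps)

lemma pderiv_legendre_recurrence:
  "real (n + 2) * poly (pderiv (legendre (Suc (Suc n)))) x
     = real (2 * n + 3) * (poly (legendre (Suc n)) x + x * poly (pderiv (legendre (Suc n))) x)
       - real (n + 1) * poly (pderiv (legendre n)) x"
  by (simp add: pderiv_smult pderiv_diff pderiv_mult pderiv_pCons field_simps)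

text \<open>The two ladder identities depend on each other. The first at \<open>Suc n\<close>
  follows from the differentiated recurrence and the second at \<open>n\<close>; the second at
  \<open>Suc n\<close> uses this together with both identities at \<open>n\<close>. Hence the joint
  induction.\<close>

lemma pderiv_legendre_eval:
  "poly (pderiv (legendre (Suc n))) x
     = x * poly (pderiv (legendre n)) x + real (n + 1) * poly (legendre n) x \<and>
   x * poly (pderiv (legendre (Suc n))) x
     = poly (pderiv (legendre n)) x + real (n + 1) * poly (legendre (Suc n)) x"
proof (induction n)
  case 0
  then show ?case by (simp add: pderiv_pCons)
next
  case (Suc n)
  define p0 p1 p2 d0 d1 d2 where defs: "p0 = poly (legendre n) x" "p1 = poly (legendre (Suc n)) x"
    "p2 = poly (legendre (Suc (Suc n))) x" "d0 = poly (pderiv (legendre n)) x"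
    "d1 = poly (pderiv (legendre (Suc n))) x" "d2 = poly (pderiv (legendre (Suc (Suc n)))) x"
  define r where "r = real n"
  have rn: "r \<ge> 0" by (simp add: r_def)
  have A: "d1 = x * d0 + (r + 1) * p0" 
    using conjunct1[OF Suc] by (simp add: defs r_def add.commute)
  have B: "x * d1 = d0 + (r + 1) * p1"
    using conjunct2[OF Suc] by (simp add: defs r_def add.commute)
  have R: "(r + 2) * p2 = (2 * r + 3) * x * p1 - (r + 1) * p0"
    using legendre_recurrence[of n x] by (simp add: defs r_def add.commute del: legendre.simps)
  have "(r + 2) * d2 = (2 * r + 3) * (p1 + x * d1) - (r + 1) * d0"
    using pderiv_legendre_recurrence[of n x] by (simp add: defs r_def add.commute del: legendre.simps)
  also have "d0 = x * d1 - (r + 1) * p1" using B by simp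
  finally have "(r + 2) * d2 = (r + 2) * (x * d1 + (r + 2) * p1)" by (simp add: algebra_simps)
  with rn have A': "d2 = x * d1 + (r + 2) * p1" by simp
  have "x * d2 = d1 + (r + 2) * p2"
  proof -
    have "x * d2 = x * (x * d1) + (r + 2) * x * p1" by (simp add: A' algebra_simps)
    also have "x * (x * d1) = d1 - (r + 1) * p0 + (r + 1) * x * p1"
      unfolding B using A by (simp add: algebra_simps)
    finally show ?thesis using R by (simp add: algebra_simps)
  qed
  with A' show ?case by (simp add: defs r_def add.commute del: legendre.simps)
qed

text \<open>Lifted from values to polynomials so that the identity can be differentiated once
  more.\<close>

lemma pderiv_legendre_Suc:
  "pderiv (legendre (Suc n)) = [:0, 1:] * pderiv (legendre n) + smult (real (n + 1)) (legendre n)"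
  using conjunct1[OF pderiv_legendre_eval[of n]] by (intro poly_ext) simp

lemma X_pderiv_legendre_Suc:
  "[:0, 1:] * pderiv (legendre (Suc n))
     = pderiv (legendre n) + smult (real (n + 1)) (legendre (Suc n))"
  using conjunct2[OF pderiv_legendre_eval[of n]] by (intro poly_ext) simp

text \<open>In terms of the ladder identities and their derivatives the second derivatives cancel.
  What remains is \<open>(r + 2) * (d0 - x * d1)\<close>, and the second ladder identity turns this
  into a multiple of \<open>p1\<close>.\<close>

lemma legendre_ode:
  "(1 - x\<^sup>2) * poly (pderiv (pderiv (legendre n))) x - 2 * x * poly (pderiv (legendre n)) x
     = - (real n * (real n + 1)) * poly (legendre n) x"
proof (cases n)
  case 0
  then show ?thesis by simp
next
  case (Suc k)
  define d0 d1 e0 e1 p1 where defs: "d0 = poly (pderiv (legendre k)) x"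
    "d1 = poly (pderiv (legendre (Suc k))) x" "e0 = poly (pderiv (pderiv (legendre k))) x"
    "e1 = poly (pderiv (pderiv (legendre (Suc k)))) x" "p1 = poly (legendre (Suc k)) x"
  define r where "r = real k"
  have B: "x * d1 = d0 + (r + 1) * p1"
    using conjunct2[OF pderiv_legendre_eval[of k x]] by (simp add: defs r_def add.commute)
  have A': "e1 = x * e0 + (r + 2) * d0"
    using arg_cong[OF pderiv_legendre_Suc[of k], of "\<lambda>q. poly (pderiv q) x"]
    by (simp add: pderiv_mult pderiv_add pderiv_smult pderiv_pCons defs r_def algebra_simps)
  have B': "x * e1 = e0 + r * d1"
    using arg_cong[OF X_pderiv_legendre_Suc[of k], of "\<lambda>q. poly (pderiv q) x"]
    by (simp add: pderiv_mult pderiv_add pderiv_smult pderiv_pCons defs r_def algebra_simps)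
  have "(1 - x\<^sup>2) * e1 - 2 * x * d1 = e1 - x * (x * e1) - 2 * (x * d1)"
    by (simp add: algebra_simps power2_eq_square)
  also have "\<dots> = - ((r + 1) * (r + 2)) * p1"
    unfolding B' unfolding A' using B by algebra
  finally show ?thesis by (simp add: Suc defs r_def add.commute)
qed

lemma poly_legendre_1 [simp]: "poly (legendre n) 1 = 1"
proof (induction n rule: legendre.induct)
  case (3 n)
  then show ?case using legendre_recurrence[of n 1] by (simp del: legendre.simps)
qed simp_all

lemma poly_legendre_minus: "poly (legendre n) (- x) = (-1) ^ n * poly (legendre n) x"
  by (induction n rule: legendre.induct) (simp_all add: field_simps)

text \<open>Up to sign the value at 0 is the central binomial coefficient divided by
  \<open>4 ^ m\<close>. The shape \<open>3 * m + 1\<close> of the denominator makes the estimate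
  inductive, with equality at \<open>m = 0\<close>.\<close>

lemma legendre_even_at_0:
  "(poly (legendre (2 * m)) 0)\<^sup>2 \<le> 1 / (3 * real m + 1)"
proof (induction m)
  case (Suc m)
  define r where "r = real m"
  have r: "r \<ge> 0" by (simp add: r_def)
  have "poly (legendre (2 * Suc m)) 0 = - ((2 * r + 1) / (2 * r + 2)) * poly (legendre (2 * m)) 0"
    by (simp add: r_def field_simps)
  then have "(poly (legendre (2 * Suc m)) 0)\<^sup>2
      = ((2 * r + 1) / (2 * r + 2))\<^sup>2 * (poly (legendre (2 * m)) 0)\<^sup>2"
    by (simp only: power_mult_distrib power2_minus)
  also have "\<dots> \<le> ((2 * r + 1) / (2 * r + 2))\<^sup>2 * (1 / (3 * r + 1))"
    using Suc by (intro mult_left_mono) (simp_all add: r_def)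
  also have "\<dots> \<le> 1 / (3 * r + 4)"
  proof -
    \<comment> \<open>The right side minus the left side is exactly \<open>r\<close>.\<close>
    have "(2 * r + 1)\<^sup>2 * (3 * r + 4) \<le> (2 * r + 2)\<^sup>2 * (3 * r + 1)"
      using r by (simp add: power2_eq_square algebra_simps)
    then show ?thesis using r by (simp add: power_divide divide_simps)
  qed
  finally show ?case by (simp add: r_def algebra_simps)
qed simp

text \<open>This makes Sonin's function at the equator equal to the square of the value there, with
  no contribution of the derivative.\<close>

lemma pderiv_legendre_even_at_0 [simp]: "poly (pderiv (legendre (2 * m))) 0 = 0"
proof (cases m)
  case (Suc k)
  have "poly (legendre (Suc (2 * k))) 0 = 0"
    using poly_legendre_minus[of "Suc (2 * k)" 0] by simp
  then show ?thesis
    using pderiv_legendre_eval[of "Suc (2 * k)" 0] by (simp add: Suc del: legendre.simps)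
qed simp

text \<open>Legendre's equation at its regular singular point \<open>x = 1\<close>, in the variable \<open>s = (1 - x) / 2\<close>.\<close>

definition legendre1 :: "nat \<Rightarrow> real poly" where
  "legendre1 n = pcompose (legendre n) [:1, -2:]"

lemma poly_legendre1: "poly (legendre1 n) s = poly (legendre n) (1 - 2 * s)"
  by (simp add: legendre1_def poly_pcompose algebra_simps)

text \<open>The hypergeometric equation with parameters \<open>-n\<close>, \<open>n + 1\<close> and
  1. As an identity of polynomials it can be read off coefficientwise, which gives a two-term
  recurrence.\<close>

lemma legendre1_ode:
  "[:0, 1, -1:] * pderiv (pderiv (legendre1 n)) + [:1, -2:] * pderiv (legendre1 n)
     + smult (real n * (real n + 1)) (legendre1 n) = 0"
proof (rule poly_ext)
  fix s
  show "poly ([:0, 1, -1:] * pderiv (pderiv (legendre1 n)) + [:1, -2:] * pderiv (legendre1 n)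
     + smult (real n * (real n + 1)) (legendre1 n)) s = poly 0 s"
    using legendre_ode[of "1 - 2 * s" n]
    by (simp add: legendre1_def pderiv_pcompose pderiv_mult pderiv_pCons poly_pcompose
        pderiv_minus pderiv_smult
        algebra_simps power2_eq_square)
qed

lemma coeff_legendre1_Suc:
  "(real k + 1)\<^sup>2 * coeff (legendre1 n) (Suc k)
     = - (real n * (real n + 1) - real k * (real k + 1)) * coeff (legendre1 n) k"
proof -
  have "coeff ([:0, 1, -1:] * pderiv (pderiv (legendre1 n)) + [:1, -2:] * pderiv (legendre1 n)
     + smult (real n * (real n + 1)) (legendre1 n)) k = 0"
    by (simp only: legendre1_ode coeff_0)
  then show ?thesis
    by (auto simp: coeff_pCons coeff_pderiv power2_eq_square algebra_simps split: nat.splits)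
qed

lemma coeff_legendre1_0 [simp]: "coeff (legendre1 n) 0 = 1"
  using poly_legendre1[of n 0] by (simp add: poly_0_coeff_0)

subsection \<open>Bounds for Legendre polynomials\<close>

text \<open>Leibniz's argument for finite sums: after the first term is split off, what is
  subtracted from \<open>b 0\<close> is a sum of the same kind for the shifted sequence. The
  induction therefore varies \<open>b\<close>.\<close>

lemma alternating_sum_bounds:
  fixes b :: "nat \<Rightarrow> real"
  assumes "\<And>k. 0 \<le> b k" and "\<And>k. b (Suc k) \<le> b k"
  shows "0 \<le> (\<Sum>k<N. (-1) ^ k * b k) \<and> (\<Sum>k<N. (-1) ^ k * b k) \<le> b 0"
  using assms
proof (induction N arbitrary: b)
  case (Suc N)
  have "(\<Sum>k<Suc N. (-1) ^ k * b k) = b 0 - (\<Sum>k<N. (-1) ^ k * b (Suc k))"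
    unfolding sum.lessThan_Suc_shift by (simp add: sum_negf)
  with Suc.IH[of "\<lambda>k. b (Suc k)"] Suc.prems show ?case by (smt (verit))
qed simp

text \<open>For \<open>t >= 0\<close> the modulus of the summand of degree \<open>k\<close> in the
  expansion at \<open>x = 1\<close>. With \<open>t\<close> and \<open>k\<close> fixed it tends, as
  \<open>n\<close> grows, to \<open>t ^ k / (k!)^2\<close>, the modulus of the corresponding summand
  of the Bessel function \<open>J_0 (2 * sqrt t)\<close>.\<close>

definition legendre1_term :: "nat \<Rightarrow> real \<Rightarrow> nat \<Rightarrow> real" where
  "legendre1_term n t k = (-1) ^ k * coeff (legendre1 n) k * (t / (real n * (real n + 1))) ^ k"

text \<open>The factor \<open>n * (n + 1) - k * (k + 1)\<close> of the recurrence is positive for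
  \<open>k < n\<close>, so the signs alternate, and it vanishes at \<open>k = n\<close>, so all
  later coefficients are zero.\<close>

lemma abs_coeff_legendre1:
  "0 \<le> (-1) ^ k * coeff (legendre1 n) k \<and> (n < k \<longrightarrow> coeff (legendre1 n) k = 0)"
proof (induction k)
  case (Suc k)
  define e where "e = (-1) ^ k * coeff (legendre1 n) k"
  have rec: "(real k + 1)\<^sup>2 * ((-1) ^ Suc k * coeff (legendre1 n) (Suc k))
      = (real n * (real n + 1) - real k * (real k + 1)) * e"
    using arg_cong[OF coeff_legendre1_Suc[of k n], of "\<lambda>y. (-1) ^ Suc k * y"]
    by (simp add: e_def algebra_simps)
  show ?case
  proof (cases "k < n")
    case True
    then have "real k * (real k + 1) \<le> real n * (real n + 1)" by (intro mult_mono) auto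
    then have "0 \<le> (real k + 1)\<^sup>2 * ((-1) ^ Suc k * coeff (legendre1 n) (Suc k))"
      unfolding rec using Suc by (simp add: e_def)
    moreover have "0 < (real k + 1)\<^sup>2" by (simp add: add_nonneg_pos)
    ultimately have "0 \<le> (-1) ^ Suc k * coeff (legendre1 n) (Suc k)"
      by (metis zero_le_mult_iff not_le)
    then show ?thesis using True by simp
  next
    case False
    then have "k = n \<or> e = 0" using Suc by (auto simp: e_def)
    then have "(real k + 1)\<^sup>2 * ((-1) ^ Suc k * coeff (legendre1 n) (Suc k)) = 0"
      unfolding rec by auto
    then show ?thesis by (auto simp: add_nonneg_eq_0_iff)
  qed
qed simp

lemma legendre1_term_nonneg: "0 \<le> t \<Longrightarrow> 0 \<le> legendre1_term n t k"
  using abs_coeff_legendre1[of k n] by (simp add: legendre1_term_def)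

lemma legendre1_term_0 [simp]: "legendre1_term n t 0 = 1"
  by (simp add: legendre1_term_def)

lemma legendre1_term_Suc:
  assumes "n > 0"
  shows "legendre1_term n t (Suc k)
    = t / (real k + 1)\<^sup>2 * (1 - real k * (real k + 1) / (real n * (real n + 1))) * legendre1_term n t k"
proof -
  define l where "l = real n * (real n + 1)"
  have l: "l > 0" using assms by (simp add: l_def)
  have k: "(real k + 1)\<^sup>2 > 0" by (simp add: add_nonneg_pos)
  have "(real k + 1)\<^sup>2 * legendre1_term n t (Suc k)
      = - ((real k + 1)\<^sup>2 * coeff (legendre1 n) (Suc k)) * (-1) ^ k * (t / l) ^ k * (t / l)"
    by (simp add: legendre1_term_def l_def)
  also have "\<dots> = (l - real k * (real k + 1)) * (t / l) * legendre1_term n t k"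
    unfolding coeff_legendre1_Suc legendre1_term_def l_def[symmetric] by (simp add: minus_mult_left[symmetric] minus_mult_right[symmetric] mult_ac del: minus_diff_eq)
  also have "\<dots> = t * (1 - real k * (real k + 1) / l) * legendre1_term n t k"
    using l by (simp add: field_simps)
  finally have "legendre1_term n t (Suc k)
      = t * (1 - real k * (real k + 1) / l) * legendre1_term n t k / (real k + 1)\<^sup>2"
    using k by (metis less_irrefl nonzero_mult_div_cancel_left)
  then show ?thesis by (simp add: l_def)
qed

lemma legendre1_term_Suc_le:
  assumes "n > 0" "0 \<le> t"
  shows "legendre1_term n t (Suc k) \<le> t / (real k + 1)\<^sup>2 * legendre1_term n t k"
proof -
  have "t / (real k + 1)\<^sup>2 * (1 - real k * (real k + 1) / (real n * (real n + 1)))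
      \<le> t / (real k + 1)\<^sup>2 * 1"
    using assms by (intro mult_left_mono) auto
  then show ?thesis
    unfolding legendre1_term_Suc[OF assms(1)]
    using assms by (intro mult_right_mono legendre1_term_nonneg) simp_all
qed

text \<open>The threshold yields decrease from index 0 on if \<open>t <= 1\<close>, and from index 1
  on if \<open>t <= 4\<close>; these are the two ranges of \<open>t\<close> treated below.\<close>

lemma legendre1_term_decreasing:
  assumes "n > 0" "0 \<le> t" "t \<le> (real k + 1)\<^sup>2"
  shows "legendre1_term n t (Suc k) \<le> legendre1_term n t k"
proof -
  have "t / (real k + 1)\<^sup>2 \<le> 1" using assms by (simp add: add_nonneg_pos divide_le_eq_1)
  then have "t / (real k + 1)\<^sup>2 * legendre1_term n t k \<le> 1 * legendre1_term n t k"
    using assms by (intro mult_right_mono legendre1_term_nonneg)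
  with legendre1_term_Suc_le[OF assms(1,2), of k] show ?thesis by simp
qed

text \<open>Summing past the degree adds only zeros. The upper limit \<open>n + 5\<close> allows the
  leading terms to be split off without regard to the size of \<open>n\<close>.\<close>

lemma legendre_expansion_at_1:
  assumes "n > 0" "t = real n * (real n + 1) * (1 - x) / 2"
  shows "poly (legendre n) x = (\<Sum>k<n + 5. (-1) ^ k * legendre1_term n t k)"
proof -
  have "poly (legendre n) x = poly (legendre1 n) ((1 - x) / 2)"
    by (simp add: poly_legendre1 diff_divide_distrib)
  also have "\<dots> = (\<Sum>k\<le>degree (legendre1 n). coeff (legendre1 n) k * ((1 - x) / 2) ^ k)"
    by (rule poly_altdef)
  also have "\<dots> = (\<Sum>k<n + 5. coeff (legendre1 n) k * ((1 - x) / 2) ^ k)"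
  proof (rule sum.mono_neutral_left)
    show "{..degree (legendre1 n)} \<subseteq> {..<n + 5}"
    proof -
      have "degree (legendre1 n) \<le> n" using abs_coeff_legendre1 by (intro degree_le) auto
      then show ?thesis by auto
    qed
  qed (auto simp: coeff_eq_0)
  also have "\<dots> = (\<Sum>k<n + 5. (-1) ^ k * legendre1_term n t k)"
  proof (rule sum.cong[OF refl])
    fix k
    have "real n * (real n + 1) \<noteq> 0" using assms(1) by (simp add: add_nonneg_eq_0_iff)
    then have "t / (real n * (real n + 1)) = (1 - x) / 2" using assms(2) by simp
    then show "coeff (legendre1 n) k * ((1 - x) / 2) ^ k = (-1) ^ k * legendre1_term n t k"
      by (simp only: legendre1_term_def) (simp add: power_mult_distrib[symmetric])
  qed
  finally show ?thesis .
qed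

text \<open>The terms decrease from the start, so the sum lies between its first two partial sums,
  and the term of index 1 is at most \<open>t\<close>.\<close>

lemma legendre_near_1:
  assumes "n > 0" "t = real n * (real n + 1) * (1 - x) / 2" "0 \<le> t" "t \<le> 1"
  shows "1 - t \<le> poly (legendre n) x" and "poly (legendre n) x \<le> 1"
proof -
  define u where "u = legendre1_term n t"
  have dec: "u (Suc k) \<le> u k" for k
  proof -
    have "1 \<le> (real k + 1)\<^sup>2" by (rule one_le_power) simp
    with assms(4) have "t \<le> (real k + 1)\<^sup>2" by (rule order_trans)
    then show ?thesis unfolding u_def using assms by (intro legendre1_term_decreasing)
  qed
  have nn: "0 \<le> u k" for k using assms by (simp add: u_def legendre1_term_nonneg)
  have P: "poly (legendre n) x = (\<Sum>k<n + 5. (-1) ^ k * u k)"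
    unfolding u_def by (rule legendre_expansion_at_1[OF assms(1,2)])
  then show "poly (legendre n) x \<le> 1"
    using alternating_sum_bounds[of u "n + 5"] dec nn by (simp add: u_def)
  have "n + 5 = Suc (n + 4)" by simp
  then have "poly (legendre n) x = 1 - (\<Sum>k<n + 4. (-1) ^ k * u (Suc k))"
    unfolding P by (simp only: sum.lessThan_Suc_shift) (simp add: u_def sum_negf)
  moreover have "(\<Sum>k<n + 4. (-1) ^ k * u (Suc k)) \<le> u 1"
    using alternating_sum_bounds[of "\<lambda>k. u (Suc k)" "n + 4"] dec nn by simp
  moreover have "u 1 \<le> t" using legendre1_term_Suc_le[OF assms(1,3), of 0] by (simp add: u_def)
  ultimately show "1 - t \<le> poly (legendre n) x" by simp
qed

text \<open>On this range \<open>J\<^sub>0 (2 \<surd>t)\<close>, the limit of \<open>poly (legendre n) x\<close> for fixed \<open>t\<close>, is below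
  \<open>-1/3\<close>.\<close>

lemma legendre_first_negative_lobe:
  assumes n: "n \<ge> 20" and t: "t = real n * (real n + 1) * (1 - x) / 2" "3 \<le> t" "t \<le> 4"
  shows "poly (legendre n) x \<le> - (1 / 4)"
proof -
  have n0: "n > 0" using n by simp
  define l where "l = real n * (real n + 1)"
  have l: "l \<ge> 420"
  proof -
    have "20 * (20 + 1) \<le> real n * (real n + 1)" using n by (intro mult_mono) auto
    then show ?thesis by (simp add: l_def)
  qed
  define u where "u = legendre1_term n t"
  have t0: "0 \<le> t" using t by simp
  have nn: "0 \<le> u k" for k using t0 by (simp add: u_def legendre1_term_nonneg)
  have dec: "u (Suc k) \<le> u k" if "k \<ge> 1" for k
  proof -
    have "(2::real)\<^sup>2 \<le> (real k + 1)\<^sup>2" using that by (intro power_mono) auto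
    then show ?thesis unfolding u_def using t n0 by (intro legendre1_term_decreasing) auto
  qed
  \<comment> \<open>Terms 0 to 3 are kept explicitly. The rest decreases, because its indices are at
    least 1, and is bounded by its first term \<open>u 4\<close>.\<close>
  have "n + 5 = Suc (Suc (Suc (Suc (n + 1))))" by simp
  then have P: "poly (legendre n) x
      = u 0 - u 1 + u 2 - u 3 + (\<Sum>k<n + 1. (-1) ^ k * u (k + 4))"
    unfolding legendre_expansion_at_1[OF n0 t(1)] u_def[symmetric]
    by (simp only: sum.lessThan_Suc_shift) (simp add: numeral_eq_Suc)
  have S: "(\<Sum>k<n + 1. (-1) ^ k * u (k + 4)) \<le> u 4"
    using alternating_sum_bounds[of "\<lambda>k. u (k + 4)" "n + 1"] dec[of "_ + 4"] nn by simp
  have u0: "u 0 = 1" by (simp add: u_def)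
  have u1: "u 1 = t" using legendre1_term_Suc[OF n0, of t 0] by (simp add: u_def)
  have u2: "u 2 = t\<^sup>2 / 4 * (1 - 2 / l)"
    using legendre1_term_Suc[OF n0, of t 1] u1
    by (simp add: u_def l_def numeral_2_eq_2 power2_eq_square)
  have u3: "u 3 = t ^ 3 / 36 * ((1 - 2 / l) * (1 - 6 / l))"
  proof -
    have "u 3 = t / 9 * (1 - 6 / l) * u 2"
      using legendre1_term_Suc[OF n0, of t 2] by (simp add: u_def l_def)
    then show ?thesis unfolding u2 by (simp add: eval_nat_numeral)
  qed
  have "u 4 \<le> t / 16 * u 3"
    using legendre1_term_Suc_le[OF n0 t0, of 3] by (simp add: u_def)
  also have "\<dots> \<le> t / 16 * (t ^ 3 / 36 * 1)"
    unfolding u3 using t0 l by (intro mult_left_mono mult_le_one) auto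
  finally have u4: "u 4 \<le> t ^ 4 / 576" by (simp add: eval_nat_numeral)
  have u2': "u 2 \<le> t\<^sup>2 / 4"
    using l mult_left_mono[of "1 - 2 / l" 1 "t\<^sup>2 / 4"] by (simp add: u2)
  have u3': "t ^ 3 / 36 - 1 / 25 \<le> u 3"
  proof -
    \<comment> \<open>The loss against the limiting term is at most
      \<open>(64 / 36) * (8 / 420)\<close>, which is below \<open>1 / 25\<close>.\<close>
    have "1 - 8 / l \<le> (1 - 2 / l) * (1 - 6 / l)" using l by (simp add: field_simps)
    then have "t ^ 3 / 36 * (1 - 8 / l) \<le> u 3" unfolding u3 using t0 by (intro mult_left_mono) auto
    moreover have "t ^ 3 / 36 * (8 / l) \<le> 4 ^ 3 / 36 * (8 / 420)"
      using t l by (intro mult_mono divide_right_mono power_mono divide_left_mono) auto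
    ultimately show ?thesis by (simp add: right_diff_distrib)
  qed
  have "poly (legendre n) x \<le> 1 - t + t\<^sup>2 / 4 - t ^ 3 / 36 + t ^ 4 / 576 + 1 / 25"
    using P S u0 u1 u2' u3' u4 by linarith
  \<comment> \<open>The truncated Bessel series equals \<open>-1/3\<close> at \<open>t = 4\<close>.
    Splitting off this root leaves a cofactor that is nonnegative on the interval from 3 to 4, and
    \<open>-1/3 + 1/25\<close> is still below \<open>-1/4\<close>.\<close>
  also have "\<dots> = (t - 4) * (t * ((t - 6)\<^sup>2 + 60) - 192) / 576 - 1 / 3 + 1 / 25"
    by (simp add: field_simps eval_nat_numeral)
  also have "(t - 4) * (t * ((t - 6)\<^sup>2 + 60) - 192) \<le> 0"
  proof (rule mult_nonpos_nonneg)
    have "2\<^sup>2 \<le> (6 - t)\<^sup>2" by (rule power_mono) (use \<open>t \<le> 4\<close> in simp_all)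
    then have "(t - 6)\<^sup>2 + 60 \<ge> 64" by (simp only: power2_commute[of t]) simp
    with \<open>3 \<le> t\<close> have "3 * 64 \<le> t * ((t - 6)\<^sup>2 + 60)" by (intro mult_mono) auto
    then show "0 \<le> t * ((t - 6)\<^sup>2 + 60) - 192" by simp
  qed (use t in simp)
  finally show ?thesis by simp
qed

text \<open>Sonin's monotone function for \<open>(sin \<theta>)\<^sup>1\<^sup>/\<^sup>2 P (cos \<theta>)\<close>, written in the variable \<open>x = cos \<theta>\<close>: the
  bracket below is \<open>P\<^sup>2\<close> plus the squared derivative over the potential of the normal form of
  Legendre's equation.\<close>

lemma legendre_sonin:
  assumes "0 \<le> x" "x < 1"
  shows "sqrt (1 - x\<^sup>2) * (poly (legendre (2 * m)) x)\<^sup>2 \<le> (poly (legendre (2 * m)) 0)\<^sup>2"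
proof -
  define n where "n = 2 * m"
  define l where "l = real n * (real n + 1)"
  have l: "l \<ge> 0" by (simp add: l_def)
  define p where "p = poly (legendre n)"
  define d where "d = poly (pderiv (legendre n))"
  \<comment> \<open>With \<open>u(theta) = sqrt (sin theta) * P (cos theta)\<close>,
    \<open>g\<close> is \<open>- sqrt (sin theta) * u'\<close> and \<open>D\<close> is
    \<open>1 - x^2\<close> times the potential \<open>l + 1/4 + 1 / (4 * (1 - x^2))\<close>. Hence
    \<open>S\<close> is \<open>u^2\<close> plus \<open>u'^2\<close> over the potential.\<close>
  define g where "g = (\<lambda>x. (1 - x\<^sup>2) * d x - x * p x / 2)"
  define D where "D = (\<lambda>x::real. (l + 1 / 4) * (1 - x\<^sup>2) + 1 / 4)"
  define S where "S = (\<lambda>x. sqrt (1 - x\<^sup>2) * ((p x)\<^sup>2 + (g x)\<^sup>2 / D x))"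
  have "S x \<le> S 0"
  proof (rule DERIV_nonpos_imp_nonincreasing[OF assms(1)])
    fix y assume "0 \<le> y" "y \<le> x"
    then have y: "0 \<le> y" "y < 1" using assms by auto
    define w where "w = 1 - y\<^sup>2"
    have w: "w > 0" using y by (simp add: w_def power_less_one_iff abs_square_less_1)
    have Dp: "D y > 0" using w l by (simp add: D_def w_def add_nonneg_pos)
    define e where "e = poly (pderiv (pderiv (legendre n))) y"
    have ode: "w * e - 2 * y * d y = - l * p y"
      using legendre_ode[of y n] by (simp add: w_def e_def d_def p_def l_def)
    define g' where "g' = - l * p y - p y / 2 - y * d y / 2"
    have dp: "(p has_real_derivative d y) (at y)" by (simp add: p_def d_def poly_DERIV)
    have dd: "(d has_real_derivative e) (at y)" by (simp add: e_def d_def poly_DERIV)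
    have dg: "(g has_real_derivative g') (at y)"
      unfolding g_def
      by (rule DERIV_cong, (rule derivative_intros dp dd)+)
        (use ode in \<open>simp_all add: g'_def w_def field_simps\<close>)
    have dD: "(D has_real_derivative - 2 * y * (l + 1 / 4)) (at y)"
      unfolding D_def by (auto intro!: derivative_eq_intros)
    define G' where "G' = 2 * p y * d y + (2 * g y * g' * D y + (g y)\<^sup>2 * (2 * y * (l + 1 / 4))) / (D y)\<^sup>2"
    have dG: "((\<lambda>x. (p x)\<^sup>2 + (g x)\<^sup>2 / D x) has_real_derivative G') (at y)"
      by (rule derivative_eq_intros dp dg dD refl)+
        (use Dp in \<open>simp_all add: G'_def power2_eq_square\<close>)
    have dw: "((\<lambda>x. sqrt (1 - x\<^sup>2)) has_real_derivative (- y / sqrt w)) (at y)"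
    proof -
      have "((\<lambda>x. 1 - x\<^sup>2) has_real_derivative - (2 * y)) (at y)"
        by (auto intro!: derivative_eq_intros)
      from DERIV_chain2[OF DERIV_real_sqrt this] w show ?thesis
        by (simp add: w_def field_simps)
    qed
    have wd: "w * d y = g y + y * p y / 2" by (simp add: g_def w_def)
    have wg: "w * g' = - p y * D y - y * g y / 2"
    proof -
      have "w * g' = - p y * (l * w + w / 2) - y * (w * d y) / 2"
        by (simp add: g'_def field_simps)
      then show ?thesis
        unfolding wd by (simp add: D_def w_def field_simps power2_eq_square)
    qed
    \<comment> \<open>Substituting the first-order system \<open>wd\<close>, \<open>wg\<close> for
      \<open>p\<close> and \<open>g\<close> cancels every term with a factor \<open>p y\<close>.
      What survives comes from the derivative of the potential and has a fixed sign for
      \<open>y >= 0\<close>.\<close>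
    have "w * G' - y * ((p y)\<^sup>2 + (g y)\<^sup>2 / D y)
        = 2 * p y * (w * d y) + (2 * g y * (w * g') * D y + w * (g y)\<^sup>2 * (2 * y * (l + 1 / 4))) / (D y)\<^sup>2
          - y * ((p y)\<^sup>2 + (g y)\<^sup>2 / D y)"
      by (simp add: G'_def field_simps)
    also have "\<dots> = - (2 * y * D y - w * (2 * y * (l + 1 / 4))) * (g y)\<^sup>2 / (D y)\<^sup>2"
      unfolding wd wg using Dp by (simp add: field_simps power2_eq_square)
    also have "2 * y * D y - w * (2 * y * (l + 1 / 4)) = y / 2"
      by (simp add: D_def w_def field_simps)
    finally have "w * G' - y * ((p y)\<^sup>2 + (g y)\<^sup>2 / D y) \<le> 0" using y by simp
    moreover have "- y / sqrt w * ((p y)\<^sup>2 + (g y)\<^sup>2 / D y) + G' * sqrt w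
        = (w * G' - y * ((p y)\<^sup>2 + (g y)\<^sup>2 / D y)) / sqrt w"
    proof -
      have "w = sqrt w * sqrt w" using w by simp
      then have "G' * sqrt w = w * G' / sqrt w" using w by (simp add: field_simps)
      then show ?thesis by (simp add: diff_divide_distrib)
    qed
    ultimately have "- y / sqrt w * ((p y)\<^sup>2 + (g y)\<^sup>2 / D y) + G' * sqrt w \<le> 0"
      using w by (simp add: divide_nonpos_pos)
    moreover have "(S has_real_derivative
        - y / sqrt w * ((p y)\<^sup>2 + (g y)\<^sup>2 / D y) + G' * sqrt w) (at y)"
      unfolding S_def using DERIV_mult[OF dw dG] by (simp add: w_def)
    ultimately show "\<exists>z. (S has_real_derivative z) (at y) \<and> z \<le> 0" by blast
  qed
  moreover have "S 0 = (p 0)\<^sup>2" by (simp add: S_def g_def d_def n_def)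
  moreover have "sqrt (1 - x\<^sup>2) * (p x)\<^sup>2 \<le> S x"
  proof -
    have "x\<^sup>2 \<le> 1" using assms by (simp add: power_le_one_iff abs_square_le_1)
    moreover from this have "0 \<le> D x" using l by (simp add: D_def)
    ultimately show ?thesis unfolding S_def by (intro mult_left_mono) auto
  qed
  ultimately show ?thesis by (simp add: p_def n_def)
qed

lemma legendre_even_bound:
  assumes "\<bar>x\<bar> < 1"
  shows "(poly (legendre (2 * m)) x)\<^sup>2 \<le> 1 / ((3 * real m + 1) * sqrt (1 - x\<^sup>2))"
proof -
  have w: "1 - x\<^sup>2 > 0" using assms by (simp add: abs_square_less_1)
  have "poly (legendre (2 * m)) \<bar>x\<bar> = poly (legendre (2 * m)) x"
    using poly_legendre_minus[of "2 * m" x] by (cases "x \<ge> 0") simp_all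
  then have "sqrt (1 - x\<^sup>2) * (poly (legendre (2 * m)) x)\<^sup>2 \<le> 1 / (3 * real m + 1)"
    using legendre_sonin[of "\<bar>x\<bar>" m] legendre_even_at_0[of m] assms by simp
  then have "(poly (legendre (2 * m)) x)\<^sup>2 \<le> 1 / (3 * real m + 1) / sqrt (1 - x\<^sup>2)"
    using w by (subst pos_le_divide_eq) (simp_all add: mult.commute)
  then show ?thesis by simp
qed

subsection \<open>Zonal eigenfunctions\<close>

definition zonal :: "real poly \<Rightarrow> real ^ 3 \<Rightarrow> real" where
  "zonal q y = poly q (y $ 3)"

abbreviation north :: "real ^ 3" where
  "north \<equiv> axis 3 1"

lemma zonal_has_derivative:
  "(zonal q has_derivative (\<lambda>v. poly (pderiv q) (y $ 3) * v $ 3)) (at y)"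
proof -
  have "((\<lambda>y :: real ^ 3. y $ 3) has_derivative (\<lambda>v. v $ 3)) (at y)"
    by (intro bounded_linear_imp_has_derivative bounded_linear_vec_nth)
  moreover have "(poly q has_derivative (*) (poly (pderiv q) (y $ 3))) (at (y $ 3))"
    using poly_DERIV[of q "y $ 3"] by (simp add: has_field_derivative_def)
  ultimately show ?thesis
    unfolding zonal_def by (rule has_derivative_compose)
qed

text \<open>A directional derivative of a zonal function is again zonal, so the induction runs over
  all polynomials at once.\<close>

lemma zonal_Ck_on: "Ck_on k (zonal q) U"
proof (induction k arbitrary: q)
  case 0
  show ?case
    using has_derivative_continuous[OF zonal_has_derivative]
    by (simp add: continuous_at_imp_continuous_on)
next
  case (Suc k)
  have "frechet_derivative (zonal q) (at y) v = zonal (smult (v $ 3) (pderiv q)) y" for y v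
    unfolding frechet_derivative_at[OF zonal_has_derivative, symmetric] by (simp add: zonal_def)
  then show ?case using Suc differentiableI[OF zonal_has_derivative] by simp
qed

lemma smooth_on_S2_zonal: "smooth_on_S2 (zonal q)"
  unfolding smooth_on_S2_def using zonal_Ck_on open_UNIV by blast

section \<open>Gradient and Laplacian of zonal functions on the sphere\<close>

lemma sgn_has_derivative:
  fixes x :: "real ^ 3"
  assumes "norm x = 1"
  shows "(sgn has_derivative tangent_proj x) (at x)"
proof -
  have "sgn x = x" and "x \<noteq> 0" using assms by (auto simp: sgn_div_norm)
  have dn: "(norm has_derivative (\<lambda>h. h \<bullet> x)) (at x)"
    using has_derivative_norm[OF \<open>x \<noteq> 0\<close>] unfolding \<open>sgn x = x\<close> .
  have "((\<lambda>y. inverse (norm y) *\<^sub>R y) has_derivative tangent_proj x) (at x)"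
    by (rule dn | rule derivative_eq_intros refl)+
      (use assms dn in \<open>auto simp: tangent_proj_def sgn_div_norm inner_commute algebra_simps\<close>)
  then show ?thesis by (simp add: sgn_div_norm[abs_def])
qed

lemma S2_differential_eq:
  assumes "norm x = 1" "(f has_derivative f') (at x)"
  shows "S2_differential f x v = f' (tangent_proj x v)"
proof -
  have "sgn x = x" using assms(1) by (simp add: sgn_div_norm)
  then have "((\<lambda>y. f (sgn y)) has_derivative (\<lambda>v. f' (tangent_proj x v))) (at x)"
    using assms(2) by (intro has_derivative_compose[OF sgn_has_derivative]) (simp_all add: assms(1))
  from frechet_derivative_at[OF this, symmetric] show ?thesis by (simp add: S2_differential_def)
qed

text \<open>Composition with \<open>sgn\<close> sees only values on the sphere, throughout the open
  set of nonzero points. Since \<open>frechet_derivative\<close> is defined by choice, it suffices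
  that both compositions admit the same derivatives. This is needed because the formula for
  \<open>S2_grad\<close> is available only on the sphere.\<close>

lemma S2_differential_cong:
  assumes "norm x = 1" "\<And>y. norm y = 1 \<Longrightarrow> f y = g y"
  shows "S2_differential f x = S2_differential g x"
proof -
  have x: "x \<in> - {0}" using assms(1) by auto
  have "((\<lambda>y. f (sgn y)) has_derivative D) (at x) \<longleftrightarrow> ((\<lambda>y. g (sgn y)) has_derivative D) (at x)" for D
    by (rule iffI; erule has_derivative_transform_within_open[of _ _ x UNIV "- {0}"])
      (use x assms(2) in \<open>auto simp: norm_sgn\<close>)
  then show ?thesis by (simp add: S2_differential_def[abs_def] frechet_derivative_def)
qed

lemma tangent_proj_orthogonal: "norm x = 1 \<Longrightarrow> tangent_proj x v \<bullet> x = 0"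
  by (simp add: tangent_proj_def inner_diff_left dot_square_norm)

lemma tangent_proj_self_adjoint: "tangent_proj x u \<bullet> v = u \<bullet> tangent_proj x v"
  by (simp add: tangent_proj_def inner_diff_left inner_diff_right inner_commute)

lemma tangent_proj_tangent: "v \<bullet> x = 0 \<Longrightarrow> tangent_proj x v = v"
  by (simp add: tangent_proj_def)

lemma S2_grad_zonal:
  assumes "norm x = 1"
  shows "S2_grad (zonal q) x = poly (pderiv q) (x $ 3) *\<^sub>R tangent_proj x north"
  unfolding S2_grad_def
proof (rule the_equality)
  have D: "S2_differential (zonal q) x v = poly (pderiv q) (x $ 3) *\<^sub>R north \<bullet> v" if "v \<bullet> x = 0" for v
    unfolding S2_differential_eq[OF assms zonal_has_derivative]
    using that by (simp add: tangent_proj_tangent inner_axis')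
  show *: "poly (pderiv q) (x $ 3) *\<^sub>R tangent_proj x north \<bullet> x = 0 \<and>
    (\<forall>v. v \<bullet> x = 0 \<longrightarrow>
      poly (pderiv q) (x $ 3) *\<^sub>R tangent_proj x north \<bullet> v = S2_differential (zonal q) x v)"
    using tangent_proj_orthogonal[OF assms, of north]
    by (simp add: D) (simp add: tangent_proj_self_adjoint tangent_proj_tangent)
  fix g assume g: "g \<bullet> x = 0 \<and> (\<forall>v. v \<bullet> x = 0 \<longrightarrow> g \<bullet> v = S2_differential (zonal q) x v)"
  \<comment> \<open>Uniqueness for the definite description: the difference of two candidates is
    tangent, hence orthogonal to itself.\<close>
  let ?h = "g - poly (pderiv q) (x $ 3) *\<^sub>R tangent_proj x north"
  have "?h \<bullet> x = 0" using g * by (simp add: inner_diff_left)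
  then have "g \<bullet> ?h = poly (pderiv q) (x $ 3) *\<^sub>R tangent_proj x north \<bullet> ?h"
    using g * by metis
  then have "?h \<bullet> ?h = 0"
    by (subst inner_diff_left) (rule right_minus_eq[THEN iffD2])
  then show "g = poly (pderiv q) (x $ 3) *\<^sub>R tangent_proj x north" by simp
qed

text \<open>On the sphere the gradient agrees with the ambient field \<open>?X\<close>, whose
  derivative is explicit; its part along \<open>x\<close> is projected away. The trace of the rest
  is \<open>p2\<close> times the squared length \<open>1 - z^2\<close> of the projected pole, minus
  \<open>p1 * z\<close> times the trace \<open>3 - 1 = 2\<close> of the tangential
  projection.\<close>

lemma S2_laplacian_zonal:
  assumes x: "norm x = 1"
  defines "z \<equiv> x $ 3"
  shows "S2_laplacian (zonal q) x
    = (1 - z\<^sup>2) * poly (pderiv (pderiv q)) z - 2 * z * poly (pderiv q) z"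
proof -
  let ?X = "\<lambda>y. zonal (pderiv q) y *\<^sub>R tangent_proj y north"
  define p1 where "p1 = poly (pderiv q) z"
  define p2 where "p2 = poly (pderiv (pderiv q)) z"
  have xx: "x \<bullet> x = 1" using x by (simp add: dot_square_norm)
  have "((\<lambda>y. tangent_proj y north) has_derivative (\<lambda>v. - ((v $ 3) *\<^sub>R x + z *\<^sub>R v))) (at x)"
    unfolding tangent_proj_def inner_axis' z_def
    by (auto intro!: derivative_eq_intros bounded_linear.has_derivative[OF bounded_linear_vec_nth] simp: algebra_simps)
  from has_derivative_scaleR[OF zonal_has_derivative[of "pderiv q"] this]
  have DX: "(?X has_derivative (\<lambda>v. - p1 *\<^sub>R ((v $ 3) *\<^sub>R x + z *\<^sub>R v)
      + (p2 * v $ 3) *\<^sub>R tangent_proj x north)) (at x)"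
    by (simp add: zonal_def z_def p1_def p2_def algebra_simps)
  have "S2_differential (S2_grad (zonal q)) x = S2_differential ?X x"
    using x by (intro S2_differential_cong) (simp_all add: S2_grad_zonal zonal_def)
  then have cov: "S2_covariant_deriv (S2_grad (zonal q)) x (tangent_proj x b) \<bullet> b
      = p2 * (tangent_proj x north \<bullet> b)\<^sup>2 - p1 * z * (1 - (x \<bullet> b)\<^sup>2)" if "b \<in> Basis" for b
  proof -
    have bb: "b \<bullet> b = 1" using that by simp
    have [simp]: "tangent_proj x (tangent_proj x v) = tangent_proj x v" for v
      by (intro tangent_proj_tangent tangent_proj_orthogonal x)
    have [simp]: "tangent_proj x x = 0" using xx by (simp add: tangent_proj_def)
    have lin: "linear (tangent_proj x)"
      by (rule linearI) (simp_all add: tangent_proj_def inner_add_left algebra_simps)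
    have v3: "tangent_proj x b $ 3 = tangent_proj x north \<bullet> b"
      by (simp add: tangent_proj_self_adjoint inner_axis')
    have "S2_covariant_deriv (S2_grad (zonal q)) x (tangent_proj x b)
      = (p2 * tangent_proj x b $ 3) *\<^sub>R tangent_proj x north - (p1 * z) *\<^sub>R tangent_proj x b"
      unfolding S2_covariant_deriv_def \<open>S2_differential (S2_grad (zonal q)) x = _\<close>
        S2_differential_eq[OF x DX]
      by (simp add: linear_add[OF lin] linear_diff[OF lin] linear_scale[OF lin] linear_neg[OF lin]
          algebra_simps)
    moreover have "tangent_proj x b \<bullet> b = 1 - (x \<bullet> b)\<^sup>2"
      by (simp add: inner_diff_left inner_diff_right power2_eq_square tangent_proj_def bb inner_commute)
    ultimately show ?thesis
      unfolding v3 by (simp add: inner_diff_left power2_eq_square)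
  qed
  have "S2_laplacian (zonal q) x
    = (\<Sum>b\<in>Basis. p2 * (tangent_proj x north \<bullet> b)\<^sup>2 - p1 * z * (1 - (x \<bullet> b)\<^sup>2))"
    unfolding S2_laplacian_def S2_div_def by (rule sum.cong[OF refl cov])
  also have "\<dots> = p2 * (\<Sum>b\<in>Basis. (tangent_proj x north \<bullet> b)\<^sup>2)
      - p1 * z * (real DIM(real ^ 3) - (\<Sum>b\<in>Basis. (x \<bullet> b)\<^sup>2))"
    by (simp add: sum_subtractf sum_distrib_left right_diff_distrib)
  also have "(\<Sum>b\<in>Basis. (x \<bullet> b)\<^sup>2) = 1"
    using xx by (simp add: euclidean_inner[of x x] power2_eq_square)
  also have "(\<Sum>b\<in>Basis. (tangent_proj x north \<bullet> b)\<^sup>2) = tangent_proj x north \<bullet> tangent_proj x north"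
    by (simp add: euclidean_inner[of "tangent_proj x north" "tangent_proj x north"] power2_eq_square)
  also have "\<dots> = 1 - z\<^sup>2"
    by (simp add: tangent_proj_def inner_diff_left inner_diff_right inner_axis inner_axis' xx z_def
        power2_eq_square)
  finally show ?thesis by (simp add: p1_def p2_def)
qed

lemma S2_eigenfunction_legendre:
  "S2_eigenfunction (zonal (legendre n)) (real n * (real n + 1))"
proof -
  have "north \<in> S2" "zonal (legendre n) north \<noteq> 0" by (simp_all add: zonal_def norm_axis_1)
  moreover have "- S2_laplacian (zonal (legendre n)) x = real n * (real n + 1) * zonal (legendre n) x"
    if "x \<in> S2" for x
    using that legendre_ode[of "x $ 3" n] by (simp add: S2_laplacian_zonal zonal_def)
  ultimately show ?thesis
    unfolding S2_eigenfunction_def using smooth_on_S2_zonal by blast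
qed

subsection \<open>Integration of zonal functions\<close>

lemma S2_param_3: "S2_param u $ 3 = cos (fst u)"
  by (simp add: S2_param_def split: prod.splits)

lemma S2_param_in_S2: "S2_param u \<in> S2"
proof -
  obtain \<theta> \<phi> where u: "u = (\<theta>, \<phi>)" by fastforce
  have "(norm (S2_param u))\<^sup>2 = (sin \<theta>)\<^sup>2 * ((cos \<phi>)\<^sup>2 + (sin \<phi>)\<^sup>2) + (cos \<theta>)\<^sup>2"
    unfolding power2_norm_eq_inner
    by (simp add: u S2_param_def inner_vec_def sum_3 power2_eq_square algebra_simps
        del: sin_cos_squared_add sin_cos_squared_add2 sin_cos_squared_add3)
  also have "\<dots> = 1" by simp
  finally have "norm (S2_param u) = 1" by (metis norm_ge_zero one_power2 power2_eq_imp_eq zero_le_one)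
  then show ?thesis by simp
qed

lemma S2_param_measurable: "S2_param \<in> borel \<rightarrow>\<^sub>M restrict_space borel S2"
proof (rule measurable_restrict_space2)
  have eq: "S2_param = (\<lambda>u. (sin (fst u) * cos (snd u)) *\<^sub>R axis 1 1
      + (sin (fst u) * sin (snd u)) *\<^sub>R axis 2 1 + cos (fst u) *\<^sub>R axis 3 1)"
    by (rule ext) (auto simp: S2_param_def vec_eq_iff forall_3 axis_def split: prod.splits)
  show "S2_param \<in> borel_measurable borel"
    unfolding eq by (intro borel_measurable_continuous_onI continuous_intros)
qed (use S2_param_in_S2 in auto)

lemma zonal_measurable_S2:
  assumes "h \<in> borel_measurable borel"
  shows "(\<lambda>x. h (x $ 3)) \<in> borel_measurable (restrict_space borel S2)"
proof (rule measurable_restrict_space1)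
  have "(\<lambda>x :: real ^ 3. x $ 3) \<in> borel_measurable borel"
    by (intro borel_measurable_continuous_onI continuous_intros)
  from measurable_compose[OF this assms] show "(\<lambda>x :: real ^ 3. h (x $ 3)) \<in> borel_measurable borel" .
qed

lemma sets_S2_measure [measurable_cong]: "sets S2_measure = sets (restrict_space borel S2)"
  by (simp add: S2_measure_def)

lemma space_S2_measure: "space S2_measure = S2"
  by (simp add: S2_measure_def space_restrict_space)

text \<open>Archimedes' hat-box theorem: the area density \<open>sin theta\<close> is the derivative
  of \<open>- cos theta\<close>, so the height is uniformly distributed.\<close>

lemma nn_integral_S2_zonal:
  fixes h :: "real \<Rightarrow> real"
  assumes h [measurable]: "h \<in> borel_measurable borel" and nn: "\<And>z. 0 \<le> h z"
  shows "(\<integral>\<^sup>+ x. ennreal (h (x $ 3)) \<partial>S2_measure)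
    = ennreal (2 * pi) * (\<integral>\<^sup>+ z. ennreal (h z * indicator {-1..1} z) \<partial>lborel)"
proof -
  define k where "k = (\<lambda>\<theta>. ennreal (h (cos \<theta>) * sin \<theta> * indicator {0..pi} \<theta>))"
  have dens: "ennreal (S2_area_density u) * indicator ({0<..<pi} \<times> {0<..<2 * pi}) u * ennreal (h (S2_param u $ 3))
      = k (fst u) * indicator {0<..<2 * pi} (snd u)" for u
  proof -
    obtain \<theta> \<phi> where u: "u = (\<theta>, \<phi>)" by fastforce
    \<comment> \<open>The closed interval in \<open>k\<close> is harmless even pointwise, because
      the sine vanishes at both poles.\<close>
    consider "0 < \<theta>" "\<theta> < pi" | "\<theta> = 0 \<or> \<theta> = pi" | "\<theta> \<notin> {0..pi}" by fastforce
    then show ?thesis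
    proof cases
      case 1
      then have "sin \<theta> > 0" by (rule sin_gt_zero)
      with 1 show ?thesis
        by (simp add: u S2_area_density_eq S2_param_3 k_def nn ennreal_mult[symmetric] mult.commute
            split: split_indicator)
    qed (auto simp: u k_def)
  qed
  have d_meas: "(\<lambda>u. ennreal (S2_area_density u) * indicator ({0<..<pi} \<times> {0<..<2 * pi}) u)
      \<in> borel_measurable borel"
  proof -
    have "S2_area_density = (\<lambda>u. \<bar>sin (fst u)\<bar>)"
      by (rule ext) (metis S2_area_density_eq prod.collapse)
    moreover have "(\<lambda>u :: real \<times> real. \<bar>sin (fst u)\<bar>) \<in> borel_measurable borel"
      by (intro borel_measurable_continuous_onI continuous_intros)
    moreover have "{0<..<pi} \<times> {0<..<2 * pi} \<in> sets (borel :: (real \<times> real) measure)"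
      by (intro borel_open open_Times) auto
    ultimately show ?thesis by simp
  qed
  have "(\<integral>\<^sup>+ x. ennreal (h (x $ 3)) \<partial>S2_measure)
      = (\<integral>\<^sup>+ u. ennreal (h (S2_param u $ 3)) \<partial>density lborel
          (\<lambda>u. ennreal (S2_area_density u) * indicator ({0<..<pi} \<times> {0<..<2 * pi}) u))"
    unfolding S2_measure_def
    using S2_param_measurable zonal_measurable_S2[OF h] by (subst nn_integral_distr) auto
  also have "\<dots> = (\<integral>\<^sup>+ u. k (fst u) * indicator {0<..<2 * pi} (snd u) \<partial>lborel)"
  proof -
    have "(\<lambda>u. ennreal (h (S2_param u $ 3))) \<in> borel_measurable lborel"
      unfolding S2_param_3
      using measurable_compose[OF borel_measurable_continuous_onI h, of "\<lambda>u :: real \<times> real. cos (fst u)"]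
      by (simp add: continuous_intros)
    then show ?thesis using d_meas by (subst nn_integral_density) (auto simp: dens)
  qed
  also have "\<dots> = (\<integral>\<^sup>+ u. k (fst u) * indicator {0<..<2 * pi} (snd u) \<partial>(lborel \<Otimes>\<^sub>M lborel))"
    by (simp add: lborel_prod)
  also have "\<dots> = (\<integral>\<^sup>+ \<theta>. \<integral>\<^sup>+ \<phi>. k \<theta> * indicator {0<..<2 * pi} \<phi> \<partial>lborel \<partial>lborel)"
    unfolding k_def by (subst lborel.nn_integral_fst[symmetric]) simp_all
  also have "\<dots> = (\<integral>\<^sup>+ \<theta>. ennreal (2 * pi) * k \<theta> \<partial>lborel)"
    by (subst nn_integral_cmult) (simp_all add: mult.commute)
  also have "\<dots> = ennreal (2 * pi) * (\<integral>\<^sup>+ \<theta>. k \<theta> \<partial>lborel)"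
    unfolding k_def by (rule nn_integral_cmult) simp
  \<comment> \<open>Substitution wants an increasing change of variable, hence \<open>- cos\<close>;
    the reflection of \<open>z\<close> afterwards removes the sign.\<close>
  also have "(\<integral>\<^sup>+ \<theta>. k \<theta> \<partial>lborel)
      = (\<integral>\<^sup>+ \<theta>. ennreal (h (- (- cos \<theta>)) * sin \<theta> * indicator {0..pi} \<theta>) \<partial>lborel)"
    by (simp add: k_def)
  also have "\<dots> = (\<integral>\<^sup>+ z. ennreal (h (- z) * indicator {- cos 0..- cos pi} z) \<partial>lborel)"
    by (rule nn_integral_substitution[symmetric])
      (auto simp: set_borel_measurable_def intro!: derivative_eq_intros continuous_intros sin_ge_zero)
  also have "\<dots> = (\<integral>\<^sup>+ z. ennreal (h (- (0 + (-1) * z)) * indicator {-1..1} (0 + (-1) * z)) \<partial>lborel)"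
    by (subst nn_integral_real_affine[of _ "-1" 0]) simp_all
  also have "\<dots> = (\<integral>\<^sup>+ z. ennreal (h z * indicator {-1..1} z) \<partial>lborel)"
    by (intro nn_integral_cong) (auto split: split_indicator)
  finally show ?thesis .
qed

lemma integral_S2_zonal:
  fixes h :: "real \<Rightarrow> real"
  assumes h: "continuous_on UNIV h" and nn: "\<And>z. 0 \<le> h z"
  shows "(\<integral> x. h (x $ 3) \<partial>S2_measure) = 2 * pi * integral {-1..1} h"
proof -
  have [measurable]: "h \<in> borel_measurable borel"
    using h by (rule borel_measurable_continuous_onI)
  have meas: "(\<lambda>x. h (x $ 3)) \<in> borel_measurable S2_measure"
    using zonal_measurable_S2[of h] by (simp add: sets_S2_measure cong: measurable_cong_sets)
  have "continuous_on {-1..1} h" using h by (rule continuous_on_subset) simp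
  then have si: "set_integrable lborel {-1..1} h" by (rule borel_integrable_atLeastAtMost')
  then have i: "integrable lborel (\<lambda>z. h z * indicator {-1..1} z)"
    by (simp add: set_integrable_def mult.commute)
  have eq: "(\<integral>\<^sup>+ x. ennreal (h (x $ 3)) \<partial>S2_measure) = ennreal (2 * pi * integral {-1..1} h)"
  proof -
    have "(\<integral>\<^sup>+ z. ennreal (h z * indicator {-1..1} z) \<partial>lborel)
        = ennreal (\<integral> z. h z * indicator {-1..1} z \<partial>lborel)"
      using i nn by (intro nn_integral_eq_integral) auto
    also have "(\<integral> z. h z * indicator {-1..1} z \<partial>lborel) = integral {-1..1} h"
      using set_borel_integral_eq_integral(2)[OF si]
      by (simp add: set_lebesgue_integral_def mult.commute)
    finally show ?thesis
      by (simp add: nn_integral_S2_zonal nn ennreal_mult'[symmetric])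
  qed
  have "integral {-1..1} h \<ge> 0"
    using set_borel_integral_eq_integral(1)[OF si] nn by (intro integral_nonneg) auto
  then show "(\<integral> x. h (x $ 3) \<partial>S2_measure) = 2 * pi * integral {-1..1} h"
    using meas nn eq by (subst integral_eq_nn_integral) auto
qed

lemma Lp_norm_zonal_finite:
  fixes h :: "real \<Rightarrow> real"
  assumes "p \<noteq> \<infinity>" "0 < p" "continuous_on UNIV h" "\<And>z. 0 \<le> h z"
  shows "Lp_norm p S2_measure (\<lambda>x. h (x $ 3))
    = (2 * pi * integral {-1..1} (\<lambda>z. h z powr enn2real p)) powr (1 / enn2real p)"
proof -
  have "enn2real p > 0" using assms by (simp add: enn2real_positive_iff less_top)
  then have "continuous_on UNIV (\<lambda>z. h z powr enn2real p)"
    using assms by (intro continuous_on_powr') auto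
  from integral_S2_zonal[OF this] assms show ?thesis
    by (simp add: Lp_norm_def)
qed

text \<open>For the lower bound, let \<open>s\<close> lie strictly between the essential supremum
  and \<open>h z0\<close>. Then the excess of \<open>h\<close> over \<open>s\<close> vanishes almost
  everywhere, so its integral over heights is zero, and by continuity it vanishes at
  \<open>z0\<close> too, a contradiction.\<close>

lemma Lp_norm_zonal_infinity:
  fixes h :: "real \<Rightarrow> real"
  assumes h: "continuous_on UNIV h" "\<And>z. 0 \<le> h z"
    and M: "\<And>z. \<bar>z\<bar> \<le> 1 \<Longrightarrow> h z \<le> M" and z0: "\<bar>z0\<bar> \<le> 1"
  shows "Lp_norm \<infinity> S2_measure (\<lambda>x. h (x $ 3)) \<in> {h z0..M}"
proof -
  define E where "E = esssup S2_measure (\<lambda>x. ereal (h (x $ 3)))"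
  have [measurable]: "h \<in> borel_measurable borel"
    using h(1) by (rule borel_measurable_continuous_onI)
  have meas: "(\<lambda>x. h (x $ 3)) \<in> borel_measurable S2_measure"
    using zonal_measurable_S2[of h] by (simp add: sets_S2_measure cong: measurable_cong_sets)
  have "E \<le> ereal M"
    unfolding E_def
  proof (rule esssup_I)
    show "AE x in S2_measure. ereal (h (x $ 3)) \<le> ereal M"
    proof (rule AE_I2)
      fix x assume "x \<in> space S2_measure"
      then have "\<bar>x $ 3\<bar> \<le> 1" using component_le_norm_cart[of x 3] by (simp add: space_S2_measure)
      then show "ereal (h (x $ 3)) \<le> ereal M" using M by simp
    qed
  qed (use meas in simp)
  moreover have "ereal (h z0) \<le> E"
  proof (rule ccontr)
    assume "\<not> ereal (h z0) \<le> E"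
    then obtain s where s: "E < ereal s" "s < h z0"
      using ereal_dense2[of E "ereal (h z0)"] by (auto simp: not_le)
    define k where "k = (\<lambda>z. max (h z - s) 0)"
    have k: "continuous_on UNIV k" using h(1) unfolding k_def by (intro continuous_intros)
    have "AE x in S2_measure. ereal (h (x $ 3)) \<le> E" unfolding E_def by (rule esssup_AE)
    then have "AE x in S2_measure. k (x $ 3) = 0"
      by eventually_elim (use s(1) in \<open>auto simp: k_def dest: order_le_less_trans\<close>)
    then have "(\<integral> x. k (x $ 3) \<partial>S2_measure) = 0"
      by (rule integral_eq_zero_AE)
    then have "integral {-1..1} k = 0"
      using integral_S2_zonal[OF k] by (simp add: k_def)
    moreover have "continuous_on {-1..1} k" using k by (rule continuous_on_subset) simp
    ultimately have "\<forall>z\<in>{-1..1}. k z = 0"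
      using integral_eq_0_iff[of "-1" 1 k] by (simp add: k_def)
    then have "k z0 = 0" using z0 by (simp add: abs_le_iff)
    then show False using s(2) by (simp add: k_def)
  qed
  ultimately show ?thesis
    using h(2) by (cases E) (auto simp: Lp_norm_def E_def)
qed

subsection \<open>Positive and negative parts\<close>

lemma poly_legendre_even_abs: "poly (legendre (2 * m)) \<bar>z\<bar> = poly (legendre (2 * m)) z"
  using poly_legendre_minus[of "2 * m" z] by (cases "z \<ge> 0") simp_all

lemma eigenvalue_ge:
  assumes "m \<ge> 10" "l = real (2 * m) * (real (2 * m) + 1)"
  shows "420 \<le> l"
proof -
  have "20 * (20 + 1) \<le> real (2 * m) * (real (2 * m) + 1)" using assms(1) by (intro mult_mono) auto
  then show ?thesis by (simp add: assms(2))
qed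

text \<open>The condition on \<open>z\<close> says that the scaled variable \<open>t\<close> is at
  most 1.\<close>

lemma legendre_even_le_1:
  assumes "m \<ge> 10" "l = real (2 * m) * (real (2 * m) + 1)" "1 - 2 / l \<le> \<bar>z\<bar>" "\<bar>z\<bar> \<le> 1"
  shows "0 \<le> poly (legendre (2 * m)) z" and "poly (legendre (2 * m)) z \<le> 1"
proof -
  have l: "420 \<le> l" using assms by (intro eigenvalue_ge)
  define t where "t = l * (1 - \<bar>z\<bar>) / 2"
  have t: "t = real (2 * m) * (real (2 * m) + 1) * (1 - \<bar>z\<bar>) / 2"
    unfolding t_def assms(2) ..
  have "l * (1 - \<bar>z\<bar>) \<le> l * (2 / l)" using l assms(3) by (intro mult_left_mono) auto
  then have t1: "0 \<le> t" "t \<le> 1" using l assms(4) by (simp_all add: t_def)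
  show "0 \<le> poly (legendre (2 * m)) z" "poly (legendre (2 * m)) z \<le> 1"
    using legendre_near_1[OF _ t t1] assms(1) t1 by (simp_all add: poly_legendre_even_abs)
qed

text \<open>Here \<open>1 - z^2 >= 2 / l\<close>, and \<open>(3 * m + 1)^2 >= 2 * l\<close>, so
  Sonin's bound gives a square of at most \<open>1/2\<close>, below \<open>(3/4)^2\<close>. The gap
  to the maximum 1 handles the sup norm and the growth of the exponent.\<close>

lemma legendre_even_tail:
  assumes "m \<ge> 10" "l = real (2 * m) * (real (2 * m) + 1)" "\<bar>z\<bar> \<le> 1 - 2 / l"
  shows "\<bar>poly (legendre (2 * m)) z\<bar> \<le> 3 / 4"
proof -
  have l: "420 \<le> l" using assms by (intro eigenvalue_ge)
  define c where "c = 1 / (3 * real m + 1)"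
  define w where "w = 1 - z\<^sup>2"
  have "z\<^sup>2 \<le> (1 - 2 / l)\<^sup>2" using assms(3) by (metis abs_ge_zero power2_abs power_mono)
  also have "\<dots> \<le> 1 - 2 / l" using l by (simp add: power2_eq_square mult_left_le field_simps)
  finally have w: "2 / l \<le> w" by (simp add: w_def)
  then have w0: "w > 0" using l by (smt (verit) divide_pos_pos)
  have "\<bar>z\<bar> < 1" using w0 by (simp add: w_def abs_square_less_1)
  then have "(poly (legendre (2 * m)) z)\<^sup>2 \<le> c / sqrt w"
    using legendre_even_bound[of z m] by (simp add: c_def w_def)
  also have "\<dots> \<le> 1 / 2"
  proof -
    have "c\<^sup>2 \<le> (1 / 4) * (2 / l)"
    proof -
      have "2 * l \<le> (3 * real m + 1)\<^sup>2"
        by (simp add: assms(2) power2_eq_square algebra_simps)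
      then have "1 / (3 * real m + 1)\<^sup>2 \<le> 1 / (2 * l)"
        using l by (intro divide_left_mono) auto
      then show ?thesis by (simp add: c_def power_divide)
    qed
    also have "\<dots> \<le> (1 / 4) * w" using w by simp
    finally have "c\<^sup>2 \<le> (sqrt w / 2)\<^sup>2" using w0 by (simp add: power_divide)
    then have "c \<le> sqrt w / 2" by (rule power2_le_imp_le) (use w0 in simp)
    then show ?thesis using w0 by (simp add: field_simps)
  qed
  also have "\<dots> \<le> (3 / 4)\<^sup>2" by (simp add: power2_eq_square)
  finally show ?thesis by (intro power2_le_imp_le[of "\<bar>_\<bar>"]) simp_all
qed

text \<open>The integrand is the power \<open>-3/2\<close> of \<open>1 - z^2\<close>, which arises
  from cubing Sonin's bound for the square.\<close>

lemma integral_arc_density: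
  fixes b :: real
  assumes "0 \<le> b" "b < 1"
  shows "((\<lambda>z. 1 / ((1 - z\<^sup>2) * sqrt (1 - z\<^sup>2))) has_integral b / sqrt (1 - b\<^sup>2)) {0..b}"
proof -
  have "((\<lambda>z. 1 / ((1 - z\<^sup>2) * sqrt (1 - z\<^sup>2))) has_integral
      (b / sqrt (1 - b\<^sup>2) - 0 / sqrt (1 - 0\<^sup>2))) {0..b}"
  proof (rule fundamental_theorem_of_calculus[OF assms(1)])
    fix z assume z: "z \<in> {0..b}"
    define w where "w = 1 - z\<^sup>2"
    have w: "w > 0" using z assms by (simp add: w_def abs_square_less_1)
    have "((\<lambda>z. 1 - z\<^sup>2) has_real_derivative - (2 * z)) (at z)"
      by (auto intro!: derivative_eq_intros)
    from DERIV_chain2[OF DERIV_real_sqrt this] w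
    have dw: "((\<lambda>z. sqrt (1 - z\<^sup>2)) has_real_derivative - z / sqrt w) (at z)"
      by (simp add: w_def field_simps)
    have sw: "sqrt w * sqrt w = w" using w by simp
    have "((\<lambda>z. z / sqrt (1 - z\<^sup>2)) has_real_derivative
        (1 * sqrt w - z * (- z / sqrt w)) / (sqrt w * sqrt w)) (at z)"
      using DERIV_divide[OF DERIV_ident dw] w by (simp add: w_def)
    also have "(1 * sqrt w - z * (- z / sqrt w)) / (sqrt w * sqrt w) = 1 / (w * sqrt w)"
    proof -
      have "1 * sqrt w - z * (- z / sqrt w) = (sqrt w * sqrt w + z\<^sup>2) / sqrt w"
        using w by (simp add: add_divide_distrib power2_eq_square real_div_sqrt)
      also have "\<dots> = 1 / sqrt w" unfolding sw by (simp add: w_def)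
      finally show ?thesis by (simp only: sw divide_divide_eq_left mult.commute)
    qed
    finally show "((\<lambda>z. z / sqrt (1 - z\<^sup>2)) has_vector_derivative 1 / ((1 - z\<^sup>2) * sqrt (1 - z\<^sup>2)))
        (at z within {0..b})"
      unfolding w_def has_real_derivative_iff_has_vector_derivative
      by (rule has_vector_derivative_at_within)
  qed
  then show ?thesis by simp
qed

section \<open>Integrals of powers of the positive and negative parts\<close>

lemma continuous_abs_poly_powr:
  fixes q :: real
  assumes "q > 0"
  shows "continuous_on A (\<lambda>z. \<bar>poly P z\<bar> powr q)"
    and "continuous_on A (\<lambda>z. max (poly P z) 0 powr q)"
    and "continuous_on A (\<lambda>z. max (- poly P z) 0 powr q)"
  using assms by (auto intro!: continuous_intros continuous_on_powr')

text \<open>Six of the \<open>q\<close> factors are estimated by Sonin's bound, the other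
  \<open>q - 6\<close> by \<open>3/4\<close>. The cubed constant \<open>c ^ 3\<close> times the
  integral, at most \<open>sqrt l / 2\<close>, is of order \<open>1 / l\<close>, the same order as
  the main lobe.\<close>

lemma legendre_even_tail_integral:
  assumes m: "m \<ge> 10" and l_def: "l = real (2 * m) * (real (2 * m) + 1)" and q: "6 \<le> q"
  shows "integral {0..1 - 2 / l} (\<lambda>z. \<bar>poly (legendre (2 * m)) z\<bar> powr q)
    \<le> (3 / 4) powr (q - 6) * (4 / (27 * l))"
proof -
  have l: "420 \<le> l" using m l_def by (rule eigenvalue_ge)
  define c where "c = 1 / (3 * real m + 1)"
  define b where "b = 1 - 2 / l"
  have b: "0 \<le> b" "b < 1" using l by (simp_all add: b_def field_simps)
  define p where "p = poly (legendre (2 * m))"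
  define K where "K = (3 / 4) powr (q - 6) * c ^ 3"
  have K: "K \<ge> 0" by (simp add: K_def c_def)
  have pointwise: "\<bar>p z\<bar> powr q \<le> K * (1 / ((1 - z\<^sup>2) * sqrt (1 - z\<^sup>2)))" if z: "z \<in> {0..b}" for z
  proof -
    define w where "w = 1 - z\<^sup>2"
    have w: "w > 0" using z b by (simp add: w_def abs_square_less_1)
    have "\<bar>p z\<bar> powr q = \<bar>p z\<bar> powr (q - 6) * \<bar>p z\<bar> powr 6"
      using powr_add[of "\<bar>p z\<bar>" "q - 6" 6] by (simp only: diff_add_cancel)
    also have "\<bar>p z\<bar> powr 6 = ((p z)\<^sup>2) ^ 3" by (simp add: power_mult[symmetric])
    also have "\<bar>p z\<bar> powr (q - 6) * ((p z)\<^sup>2) ^ 3 \<le> (3 / 4) powr (q - 6) * (c / sqrt w) ^ 3"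
    proof (intro mult_mono powr_mono2 power_mono)
      show "\<bar>p z\<bar> \<le> 3 / 4"
        unfolding p_def using z by (intro legendre_even_tail[OF m l_def]) (simp add: b_def)
      show "(p z)\<^sup>2 \<le> c / sqrt w"
        using legendre_even_bound[of z m] z b by (simp add: p_def c_def w_def)
    qed (use q in simp_all)
    also have "\<dots> = K * (1 / (w * sqrt w))"
      using w by (simp add: K_def power_divide power3_eq_cube)
    finally show ?thesis by (simp add: w_def)
  qed
  have "integral {0..b} (\<lambda>z. \<bar>p z\<bar> powr q) \<le> K * (b / sqrt (1 - b\<^sup>2))"
  proof (rule has_integral_le)
    show "((\<lambda>z. \<bar>p z\<bar> powr q) has_integral integral {0..b} (\<lambda>z. \<bar>p z\<bar> powr q)) {0..b}"
      unfolding p_def using q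
      by (intro integrable_integral integrable_continuous_interval continuous_abs_poly_powr) simp
    show "((\<lambda>z. K * (1 / ((1 - z\<^sup>2) * sqrt (1 - z\<^sup>2)))) has_integral K * (b / sqrt (1 - b\<^sup>2))) {0..b}"
      by (rule has_integral_mult_right) (rule integral_arc_density[OF b])
  qed (rule pointwise)
  also have "\<dots> \<le> K * (sqrt l / 2)"
  proof (rule mult_left_mono[OF _ K])
    \<comment> \<open>In terms of \<open>u = 1 / l\<close> the required inequality reduces to
      \<open>b^2 <= 1 - u\<close>.\<close>
    define u where "u = 1 / l"
    have u: "0 < u" "u \<le> 1 / 420" "l * u = 1" using l by (simp_all add: u_def field_simps)
    have bu: "b = 1 - 2 * u" by (simp add: b_def u_def)
    have b2: "1 - b\<^sup>2 > 0" using b by (simp add: abs_square_less_1)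
    have "l * (1 - b\<^sup>2) / 4 = (l * u) * (1 - u)"
      by (simp add: bu power2_eq_square field_simps)
    then have lb: "l * (1 - b\<^sup>2) / 4 = 1 - u" using u by simp
    have "b\<^sup>2 = 1 - u - u * (3 - 4 * u)" by (simp add: bu power2_eq_square algebra_simps)
    also have "\<dots> \<le> 1 - u" using u by simp
    finally have "b\<^sup>2 \<le> l * (1 - b\<^sup>2) / 4" by (simp only: lb)
    then have "b\<^sup>2 / (1 - b\<^sup>2) \<le> l / 4" using b2 by (simp add: field_simps)
    then have "(b / sqrt (1 - b\<^sup>2))\<^sup>2 \<le> (sqrt l / 2)\<^sup>2"
      using b2 l by (simp add: power_divide)
    then show "b / sqrt (1 - b\<^sup>2) \<le> sqrt l / 2"
      by (rule power2_le_imp_le) (use l in simp)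
  qed
  also have "\<dots> = (3 / 4) powr (q - 6) * ((c * sqrt l) ^ 3 / (2 * l))"
  proof -
    have "sqrt l ^ 3 = l * sqrt l" using l by (simp add: power3_eq_cube)
    then show ?thesis using l by (simp add: K_def power_mult_distrib)
  qed
  also have "\<dots> \<le> (3 / 4) powr (q - 6) * ((2 / 3) ^ 3 / (2 * l))"
  proof -
    \<comment> \<open>The bound \<open>2/3\<close> for \<open>c * sqrt l\<close> is also its limit
      for large \<open>m\<close>.\<close>
    have "9 * l \<le> 4 * (3 * real m + 1)\<^sup>2" by (simp add: l_def power2_eq_square algebra_simps)
    then have "c\<^sup>2 * l \<le> (2 / 3)\<^sup>2" by (simp add: c_def power_divide field_simps)
    then have "(c * sqrt l)\<^sup>2 \<le> (2 / 3)\<^sup>2" using l by (simp add: power_mult_distrib)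
    then have "c * sqrt l \<le> 2 / 3" by (rule power2_le_imp_le) simp
    then show ?thesis
      using l by (intro mult_left_mono divide_right_mono power_mono) (auto simp: c_def)
  qed
  also have "\<dots> = (3 / 4) powr (q - 6) * (4 / (27 * l))"
    by (simp add: power3_eq_cube)
  finally show ?thesis by (simp add: b_def p_def)
qed

text \<open>Both sides are 1 at \<open>q = 6\<close>, and Bernoulli's inequality with
  \<open>ln (4/3) >= 1/4 > 1/7\<close> does the rest. The tail thereby gets the same dependence
  \<open>1 / (q + 1)\<close> as the main lobe.\<close>

lemma powr_three_quarters_le:
  assumes "6 \<le> (q :: real)"
  shows "(3 / 4) powr (q - 6) \<le> 7 / (q + 1)"
proof -
  have "1 / 4 \<le> ln (4 / 3 :: real)"
    using ln_le_minus_one[of "3 / 4 :: real"] by (simp add: ln_div)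
  then have "1 + (q - 6) / 7 \<le> 1 + (q - 6) * ln (4 / 3)"
    using assms mult_left_mono[of "1 / 4" "ln (4 / 3)" "q - 6"] by simp
  also have "\<dots> \<le> exp ((q - 6) * ln (4 / 3))" by (rule exp_ge_add_one_self)
  also have "\<dots> = (4 / 3) powr (q - 6)" by (simp add: powr_def)
  finally have "(q + 1) / 7 \<le> (4 / 3) powr (q - 6)" by (simp add: field_simps)
  moreover have "(3 / 4) powr (q - 6) = 1 / (4 / 3 :: real) powr (q - 6)"
    by (simp add: powr_divide)
  moreover have "1 / (4 / 3) powr (q - 6) \<le> 1 / ((q + 1) / 7)"
    using calculation(1) assms by (intro divide_left_mono) auto
  ultimately show ?thesis by simp
qed

lemma legendre_even_main_lobe_integral:
  assumes m: "m \<ge> 10" and l_def: "l = real (2 * m) * (real (2 * m) + 1)" and q: "6 \<le> q"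
  shows "127 / (64 * l * (q + 1)) \<le> integral {0..1} (\<lambda>z. max (poly (legendre (2 * m)) z) 0 powr q)"
proof -
  have l: "420 \<le> l" using m l_def by (rule eigenvalue_ge)
  define p where "p = poly (legendre (2 * m))"
  define s where "s = (\<lambda>z. 1 - l * (1 - z) / 2)"
  define F where "F = (\<lambda>z. 2 / (l * (q + 1)) * s z powr (q + 1))"
  \<comment> \<open>Integrating \<open>(1 - t) powr q\<close> only up to \<open>t = 1/2\<close>
    keeps the base positive for differentiation. As \<open>q >= 6\<close>, this costs at most the
    factor \<open>127/128\<close>.\<close>
  define a where "a = 1 - 1 / l"
  have a: "0 \<le> a" "a \<le> 1" using l by (simp_all add: a_def)
  have s_ge: "1 / 2 \<le> s z" if "a \<le> z" for z
  proof -
    have "l * (1 - z) \<le> l * (1 / l)" using that l by (intro mult_left_mono) (auto simp: a_def)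
    then show ?thesis using l by (simp add: s_def)
  qed
  have main: "((\<lambda>z. s z powr q) has_integral (F 1 - F a)) {a..1}"
  proof (rule fundamental_theorem_of_calculus[OF a(2)])
    fix z assume "z \<in> {a..1}"
    then have sz: "s z > 0" using s_ge[of z] by simp
    have ds: "(s has_real_derivative l / 2) (at z)"
      unfolding s_def by (auto intro!: derivative_eq_intros)
    have "((\<lambda>z. s z powr (q + 1)) has_real_derivative (q + 1) * s z powr (q + 1 - 1) * (l / 2)) (at z)"
      using DERIV_fun_powr[OF ds sz, of "q + 1"] by simp
    from DERIV_cmult[OF this, of "2 / (l * (q + 1))"]
    have "(F has_real_derivative s z powr q) (at z)"
      using l q by (simp add: F_def)
    then show "(F has_vector_derivative s z powr q) (at z within {a..1})"
      unfolding has_real_derivative_iff_has_vector_derivative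
      by (rule has_vector_derivative_at_within)
  qed
  have "127 / (64 * l * (q + 1)) \<le> F 1 - F a"
  proof -
    define Y where "Y = 2 / (l * (q + 1))"
    have sa: "s a = 1 / 2" using l by (simp add: s_def a_def)
    have "(1 / 2) powr (q + 1) \<le> (1 / 2 :: real) powr 7"
      using q by (intro powr_mono') auto
    moreover have "(1 / 2 :: real) powr 7 = 1 / 128" by (simp add: power_divide)
    ultimately have "F a \<le> Y * (1 / 128)"
      unfolding F_def sa Y_def using l q by (intro mult_left_mono) auto
    moreover have "F 1 = Y" by (simp add: F_def s_def Y_def)
    moreover have eq: "127 / (64 * l * (q + 1)) = 127 / 128 * Y" by (simp add: Y_def)
    ultimately show ?thesis unfolding eq by linarith
  qed
  also have "F 1 - F a \<le> integral {a..1} (\<lambda>z. max (p z) 0 powr q)"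
  proof (rule has_integral_le[OF main])
    show "((\<lambda>z. max (p z) 0 powr q) has_integral integral {a..1} (\<lambda>z. max (p z) 0 powr q)) {a..1}"
      unfolding p_def using q
      by (intro integrable_integral integrable_continuous_interval continuous_abs_poly_powr) simp
    fix z assume z: "z \<in> {a..1}"
    have "s z \<le> p z"
      unfolding s_def p_def l_def
    proof (rule legendre_near_1(1)[OF _ refl])
      show "0 \<le> real (2 * m) * (real (2 * m) + 1) * (1 - z) / 2" using z by simp
      show "real (2 * m) * (real (2 * m) + 1) * (1 - z) / 2 \<le> 1"
        using s_ge[of z] z unfolding s_def l_def by simp
    qed (use m in simp)
    then show "s z powr q \<le> max (p z) 0 powr q"
      using s_ge[of z] z q by (intro powr_mono2) auto
  qed
  also have "\<dots> \<le> integral {0..1} (\<lambda>z. max (p z) 0 powr q)"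
    unfolding p_def using a q
    by (intro integral_subset_le integrable_continuous_interval continuous_abs_poly_powr) auto
  finally show ?thesis by (simp add: p_def)
qed

text \<open>A crude bound that serves only to keep the ratio of the norms bounded: the cap has
  length \<open>2 / l\<close> and the tail contributes less than that.\<close>

lemma legendre_even_positive_part_le:
  assumes m: "m \<ge> 10" and l_def: "l = real (2 * m) * (real (2 * m) + 1)" and q: "6 \<le> q"
  shows "integral {0..1} (\<lambda>z. max (poly (legendre (2 * m)) z) 0 powr q) \<le> 4 / l"
proof -
  have l: "420 \<le> l" using m l_def by (rule eigenvalue_ge)
  define p where "p = poly (legendre (2 * m))"
  define b where "b = 1 - 2 / l"
  have b: "0 \<le> b" "b \<le> 1" using l by (simp_all add: b_def)
  have int: "(\<lambda>z. max (p z) 0 powr q) integrable_on {u..v}" "(\<lambda>z. \<bar>p z\<bar> powr q) integrable_on {u..v}"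
    for u v unfolding p_def using q
    by (auto intro!: integrable_continuous_interval continuous_abs_poly_powr)
  have "integral {0..1} (\<lambda>z. max (p z) 0 powr q)
      = integral {0..b} (\<lambda>z. max (p z) 0 powr q) + integral {b..1} (\<lambda>z. max (p z) 0 powr q)"
    using b int by (intro Henstock_Kurzweil_Integration.integral_combine[symmetric]) auto
  also have "integral {b..1} (\<lambda>z. max (p z) 0 powr q) \<le> integral {b..1} (\<lambda>_. 1)"
  proof (rule integral_le)
    fix z assume z: "z \<in> {b..1}"
    have "max (p z) 0 \<le> 1"
      using legendre_even_le_1(2)[OF m l_def, of z] z b by (simp add: p_def b_def)
    then show "max (p z) 0 powr q \<le> 1" using q by (intro powr_le1) auto
  qed (use int in auto)
  also have "integral {b..1} (\<lambda>_. 1 :: real) = 2 / l" using b by (simp add: b_def)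
  also have "integral {0..b} (\<lambda>z. max (p z) 0 powr q) \<le> integral {0..b} (\<lambda>z. \<bar>p z\<bar> powr q)"
    using q by (intro integral_le int powr_mono2) auto
  also have "\<dots> \<le> (3 / 4) powr (q - 6) * (4 / (27 * l))"
    using legendre_even_tail_integral[OF m l_def q] by (simp add: p_def b_def)
  also have "\<dots> \<le> 1 * (4 / (27 * l))"
    using l q by (intro mult_right_mono powr_le1) auto
  also have "1 * (4 / (27 * l)) \<le> 2 / l" using l by (simp add: field_simps)
  finally show ?thesis by (simp add: p_def)
qed

text \<open>The polynomial is nonnegative for \<open>t <= 1\<close>, so only the tail
  contributes.\<close>

lemma legendre_even_negative_part_le:
  assumes m: "m \<ge> 10" and l_def: "l = real (2 * m) * (real (2 * m) + 1)" and q: "6 \<le> q"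
  shows "integral {0..1} (\<lambda>z. max (- poly (legendre (2 * m)) z) 0 powr q) \<le> 28 / (27 * l * (q + 1))"
proof -
  have l: "420 \<le> l" using m l_def by (rule eigenvalue_ge)
  define p where "p = poly (legendre (2 * m))"
  define b where "b = 1 - 2 / l"
  have b: "0 \<le> b" "b \<le> 1" using l by (simp_all add: b_def)
  have int: "(\<lambda>z. max (- p z) 0 powr q) integrable_on {u..v}" "(\<lambda>z. \<bar>p z\<bar> powr q) integrable_on {u..v}"
    for u v unfolding p_def using q
    by (auto intro!: integrable_continuous_interval continuous_abs_poly_powr)
  have "integral {0..1} (\<lambda>z. max (- p z) 0 powr q)
      = integral {0..b} (\<lambda>z. max (- p z) 0 powr q) + integral {b..1} (\<lambda>z. max (- p z) 0 powr q)"
    using b int by (intro Henstock_Kurzweil_Integration.integral_combine[symmetric]) auto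
  also have "integral {b..1} (\<lambda>z. max (- p z) 0 powr q) = integral {b..1} (\<lambda>_. 0)"
  proof (rule integral_cong)
    fix z assume z: "z \<in> {b..1}"
    have "0 \<le> p z"
      using legendre_even_le_1(1)[OF m l_def, of z] z b by (simp add: p_def b_def)
    then show "max (- p z) 0 powr q = 0" using q by simp
  qed
  also have "integral {0..b} (\<lambda>z. max (- p z) 0 powr q) \<le> integral {0..b} (\<lambda>z. \<bar>p z\<bar> powr q)"
    using q by (intro integral_le int powr_mono2) auto
  also have "\<dots> \<le> (3 / 4) powr (q - 6) * (4 / (27 * l))"
    using legendre_even_tail_integral[OF m l_def q] by (simp add: p_def b_def)
  also have "\<dots> \<le> 7 / (q + 1) * (4 / (27 * l))"
    using l by (intro mult_right_mono powr_three_quarters_le[OF q]) auto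
  finally show ?thesis by (simp add: p_def mult_ac)
qed

text \<open>The range of \<open>t\<close> from 3 to 4 is an interval of length \<open>2 / l\<close>
  in \<open>z\<close>. Its contribution keeps the denominator of the ratio away from 0 on the scale
  \<open>1 / l\<close>.\<close>

lemma legendre_even_negative_part_ge:
  assumes m: "m \<ge> 10" and l_def: "l = real (2 * m) * (real (2 * m) + 1)" and q: "6 \<le> q"
  shows "2 / l * (1 / 4) powr q \<le> integral {0..1} (\<lambda>z. max (- poly (legendre (2 * m)) z) 0 powr q)"
proof -
  have l: "420 \<le> l" using m l_def by (rule eigenvalue_ge)
  define p where "p = poly (legendre (2 * m))"
  have int: "(\<lambda>z. max (- p z) 0 powr q) integrable_on {u..v}" for u v
    unfolding p_def using q by (auto intro!: integrable_continuous_interval continuous_abs_poly_powr)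
  have ab: "0 \<le> 1 - 8 / l" "1 - 8 / l \<le> 1 - 6 / l" "1 - 6 / l \<le> 1"
    using l by (simp_all add: divide_right_mono)
  have "2 / l * (1 / 4) powr q = integral {1 - 8 / l..1 - 6 / l} (\<lambda>_. (1 / 4) powr q)"
    using ab by (simp add: field_simps)
  also have "\<dots> \<le> integral {1 - 8 / l..1 - 6 / l} (\<lambda>z. max (- p z) 0 powr q)"
  proof (intro integral_le int powr_mono2)
    fix z assume z: "z \<in> {1 - 8 / l..1 - 6 / l}"
    have "l * (6 / l) \<le> l * (1 - z)" by (rule mult_left_mono) (use z l in auto)
    moreover have "l * (1 - z) \<le> l * (8 / l)" by (rule mult_left_mono) (use z l in auto)
    ultimately have t: "3 \<le> l * (1 - z) / 2" "l * (1 - z) / 2 \<le> 4" using l by auto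
    have "p z \<le> - (1 / 4)"
      unfolding p_def
      by (rule legendre_first_negative_lobe[OF _ refl]) (use m t in \<open>auto simp: l_def\<close>)
    then show "1 / 4 \<le> max (- p z) 0" by simp
  qed (use q in auto)
  also have "\<dots> \<le> integral {0..1} (\<lambda>z. max (- p z) 0 powr q)"
    using ab int by (intro integral_subset_le) auto
  finally show ?thesis by (simp add: p_def)
qed

section \<open>The ratio of the norms and its compact range\<close>

definition sign_ratio :: "ennreal \<Rightarrow> nat \<Rightarrow> real" where
  "sign_ratio p m =
     Lp_norm p S2_measure (\<lambda>x. max (zonal (legendre (2 * m)) x) 0) /
     Lp_norm p S2_measure (\<lambda>x. max (- zonal (legendre (2 * m)) x) 0)"

lemma integral_even:
  fixes h :: "real \<Rightarrow> real"
  assumes h: "continuous_on UNIV h" and even: "\<And>z. h (- z) = h z"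
  shows "integral {-1..1} h = 2 * integral {0..1} h"
proof -
  have "h integrable_on {-1..1}"
    using h by (intro integrable_continuous_interval) (rule continuous_on_subset, auto)
  then have "integral {-1..1} h = integral {-1..0} h + integral {0..1} h"
    by (intro Henstock_Kurzweil_Integration.integral_combine[symmetric]) auto
  moreover have "integral {-1..0} h = integral {0..1} h"
    using Henstock_Kurzweil_Integration.integral_reflect_real[of 1 0 h] by (simp add: even)
  ultimately show ?thesis by simp
qed

text \<open>The factor \<open>4 * pi\<close> from azimuth and evenness cancels, and so does
  \<open>l\<close>, so the bounds depend on \<open>q\<close> alone and hold for all
  \<open>m >= 10\<close>.\<close>

lemma sign_ratio_finite_bounds:
  assumes p: "6 \<le> p" "p \<noteq> \<infinity>" and m: "m \<ge> 10"
  defines "q \<equiv> enn2real p"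
  shows "sign_ratio p m \<in> {(3 / 2) powr (1 / q)..(2 * 4 powr q) powr (1 / q)}"
proof -
  define l where "l = real (2 * m) * (real (2 * m) + 1)"
  have l: "420 \<le> l" using m l_def by (rule eigenvalue_ge)
  have q: "6 \<le> q"
    using enn2real_mono[OF p(1)] p(2) by (simp add: q_def less_top)
  have p0: "0 < p" using p(1) by (rule less_le_trans[rotated]) simp
  define P where "P = poly (legendre (2 * m))"
  define Np where "Np = integral {0..1} (\<lambda>z. max (P z) 0 powr q)"
  define Nm where "Nm = integral {0..1} (\<lambda>z. max (- P z) 0 powr q)"
  have even: "P (- z) = P z" for z by (simp add: P_def poly_legendre_minus)
  have "Lp_norm p S2_measure (\<lambda>x. max (zonal (legendre (2 * m)) x) 0)
      = (2 * pi * integral {-1..1} (\<lambda>z. max (P z) 0 powr q)) powr (1 / q)"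
    using Lp_norm_zonal_finite[OF p(2) p0, of "\<lambda>z. max (P z) 0"]
    by (simp add: zonal_def P_def q_def continuous_intros)
  also have "integral {-1..1} (\<lambda>z. max (P z) 0 powr q) = 2 * Np"
    unfolding Np_def using q by (intro integral_even) (auto simp: even, auto simp: P_def intro!: continuous_abs_poly_powr)
  finally have A: "Lp_norm p S2_measure (\<lambda>x. max (zonal (legendre (2 * m)) x) 0)
      = (4 * pi * Np) powr (1 / q)" by (simp add: mult.assoc)
  have "Lp_norm p S2_measure (\<lambda>x. max (- zonal (legendre (2 * m)) x) 0)
      = (2 * pi * integral {-1..1} (\<lambda>z. max (- P z) 0 powr q)) powr (1 / q)"
    using Lp_norm_zonal_finite[OF p(2) p0, of "\<lambda>z. max (- P z) 0"]
    by (simp add: zonal_def P_def q_def continuous_intros)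
  also have "integral {-1..1} (\<lambda>z. max (- P z) 0 powr q) = 2 * Nm"
    unfolding Nm_def using q by (intro integral_even) (auto simp: even, auto simp: P_def intro!: continuous_abs_poly_powr)
  finally have B: "Lp_norm p S2_measure (\<lambda>x. max (- zonal (legendre (2 * m)) x) 0)
      = (4 * pi * Nm) powr (1 / q)" by (simp add: mult.assoc)
  have Np: "127 / (64 * l * (q + 1)) \<le> Np" "Np \<le> 4 / l"
    unfolding Np_def P_def
    using legendre_even_main_lobe_integral[OF m l_def q] legendre_even_positive_part_le[OF m l_def q]
    by auto
  have Nm: "2 / l * (1 / 4) powr q \<le> Nm" "Nm \<le> 28 / (27 * l * (q + 1))"
    unfolding Nm_def P_def
    using legendre_even_negative_part_ge[OF m l_def q] legendre_even_negative_part_le[OF m l_def q]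
    by auto
  have "2 / l * (1 / 4) powr q > 0" using l by simp
  then have Nm0: "Nm > 0" using Nm(1) by linarith
  have "127 / (64 * l * (q + 1)) > 0" using l q by simp
  then have Np0: "Np > 0" using Np(1) by linarith
  \<comment> \<open>Both estimates carry \<open>1 / (l * (q + 1))\<close>, and
    \<open>3/2 * 28/27 = 14/9\<close> is below \<open>127/64\<close>.\<close>
  have "3 / 2 * Nm \<le> 3 / 2 * (28 / (27 * (l * (q + 1))))"
    using Nm(2) unfolding mult.assoc by (rule mult_left_mono) simp
  also have "\<dots> \<le> 127 / (64 * (l * (q + 1)))" using l q by (simp add: divide_simps)
  also have "\<dots> \<le> Np" using Np(1) by (simp add: mult.assoc)
  finally have lower: "3 / 2 \<le> Np / Nm" using Nm0 by (simp add: field_simps)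
  have "Np \<le> 2 * 4 powr q * (2 / l * (1 / 4) powr q)" using Np(2) by (simp add: powr_divide)
  also have "\<dots> \<le> 2 * 4 powr q * Nm" using Nm(1) by (intro mult_left_mono) auto
  finally have upper: "Np / Nm \<le> 2 * 4 powr q" using Nm0 by (simp add: field_simps)
  have "sign_ratio p m = (4 * pi * Np) powr (1 / q) / (4 * pi * Nm) powr (1 / q)"
    unfolding sign_ratio_def A B ..
  also have "\<dots> = (Np / Nm) powr (1 / q)"
    using Np0 Nm0 by (simp add: powr_divide[symmetric])
  finally show ?thesis
    using lower upper q Np0 Nm0 by (auto intro!: powr_mono2)
qed

text \<open>The value 1 at the pole fixes the numerator. The denominator is at most
  \<open>3/4\<close> by the tail bound and at least \<open>1/4\<close> by the value at
  \<open>t = 3\<close>.\<close>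

lemma sign_ratio_infinity_bounds:
  assumes m: "m \<ge> 10"
  shows "sign_ratio \<infinity> m \<in> {4 / 3..4}"
proof -
  define l where "l = real (2 * m) * (real (2 * m) + 1)"
  have l: "420 \<le> l" using m l_def by (rule eigenvalue_ge)
  define P where "P = poly (legendre (2 * m))"
  have bounds: "P z \<le> 1 \<and> - P z \<le> 3 / 4" if "\<bar>z\<bar> \<le> 1" for z
  proof (cases "\<bar>z\<bar> \<le> 1 - 2 / l")
    case True
    from legendre_even_tail[OF m l_def this] show ?thesis by (auto simp: P_def)
  next
    case False
    with legendre_even_le_1[OF m l_def _ that] show ?thesis by (simp add: P_def)
  qed
  have cont: "continuous_on UNIV (\<lambda>z. max (P z) 0)" "continuous_on UNIV (\<lambda>z. max (- P z) 0)"
    by (auto simp: P_def intro!: continuous_intros)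
  have "Lp_norm \<infinity> S2_measure (\<lambda>x. max (P (x $ 3)) 0) \<in> {max (P 1) 0..1}"
    using bounds by (intro Lp_norm_zonal_infinity cont) auto
  then have A: "Lp_norm \<infinity> S2_measure (\<lambda>x. max (P (x $ 3)) 0) = 1" by (simp add: P_def)
  define z where "z = 1 - 6 / l"
  have z: "\<bar>z\<bar> \<le> 1" using l by (simp add: z_def)
  have "l * (1 - z) / 2 = 3" using l by (simp add: z_def)
  then have "P z \<le> - (1 / 4)"
    unfolding P_def
    by (intro legendre_first_negative_lobe[OF _ refl]) (use m in \<open>simp_all add: l_def\<close>)
  moreover have "Lp_norm \<infinity> S2_measure (\<lambda>x. max (- P (x $ 3)) 0) \<in> {max (- P z) 0..3 / 4}"
  proof (intro Lp_norm_zonal_infinity cont z)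
    show "max (- P z) 0 \<le> 3 / 4" if "\<bar>z\<bar> \<le> 1" for z using bounds[OF that] by (auto simp: max_def)
  qed simp
  ultimately have "1 / 4 \<le> Lp_norm \<infinity> S2_measure (\<lambda>x. max (- P (x $ 3)) 0)"
    "Lp_norm \<infinity> S2_measure (\<lambda>x. max (- P (x $ 3)) 0) \<le> 3 / 4" by auto
  then show ?thesis
    using A by (simp add: sign_ratio_def zonal_def P_def divide_simps)
qed

lemma sign_ratio_bounds:
  assumes "6 \<le> p"
  obtains a b where "1 < a" "\<And>m. m \<ge> 10 \<Longrightarrow> sign_ratio p m \<in> {a..b}"
proof (cases "p = \<infinity>")
  case True
  then show ?thesis using that[of "4 / 3" 4] sign_ratio_infinity_bounds by simp
next
  case False
  have "6 \<le> enn2real p"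
    using enn2real_mono[OF assms] False by (simp add: less_top)
  then have "1 < (3 / 2 :: real) powr (1 / enn2real p)" by (simp add: gr_one_powr)
  then show ?thesis using that sign_ratio_finite_bounds[OF assms False] by blast
qed

theorem theorem2:
  fixes p :: ennreal
  assumes "6 \<le> p"
  shows "\<exists>(\<psi> :: nat \<Rightarrow> real ^ 3 \<Rightarrow> real) (l :: nat \<Rightarrow> real) (L :: real).
           (\<forall>n\<ge>1. S2_eigenfunction (\<psi> n) (l n)) \<and>
           filterlim l at_top sequentially \<and>
           (\<lambda>n. Lp_norm p S2_measure (\<lambda>x. max (\<psi> n x) 0) /
                Lp_norm p S2_measure (\<lambda>x. max (- \<psi> n x) 0)) \<longlonglongrightarrow> L \<and>
           L > 1"
proof -
  obtain a b where a: "1 < a" and ab: "\<And>m. m \<ge> 10 \<Longrightarrow> sign_ratio p m \<in> {a..b}"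
    using sign_ratio_bounds[OF assms] by metis
  \<comment> \<open>Boundedness alone gives no limit, so a convergent subsequence is chosen; the
    shift by 10 reaches the range of the bounds, and the lower endpoint \<open>a > 1\<close> passes
    to the limit.\<close>
  have "seq_compact {a..b}" by (simp add: compact_imp_seq_compact)
  moreover have "\<forall>n. sign_ratio p (n + 10) \<in> {a..b}" using ab by simp
  ultimately obtain L r where L: "L \<in> {a..b}" and r: "strict_mono r"
    and lim: "((\<lambda>n. sign_ratio p (n + 10)) \<circ> r) \<longlonglongrightarrow> L"
    by (rule seq_compactE)
  \<comment> \<open>The degrees along the subsequence; strict monotonicity of \<open>r\<close> gives
    \<open>n <= k n\<close>, so the eigenvalues still diverge.\<close>
  define k where "k = (\<lambda>n. 2 * (r n + 10))"
  have k_ge: "n \<le> k n" for n using seq_suble[OF r, of n] by (simp add: k_def)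
  have "filterlim (\<lambda>n. real (k n) * (real (k n) + 1)) at_top sequentially"
  proof (rule filterlim_at_top_mono[OF filterlim_real_sequentially always_eventually], rule allI)
    fix n
    have "real n * 1 \<le> real (k n) * (real (k n) + 1)" using k_ge[of n] by (intro mult_mono) auto
    then show "real n \<le> real (k n) * (real (k n) + 1)" by simp
  qed
  moreover have "\<forall>n\<ge>1. S2_eigenfunction (zonal (legendre (k n))) (real (k n) * (real (k n) + 1))"
    using S2_eigenfunction_legendre by blast
  moreover have "(\<lambda>n. Lp_norm p S2_measure (\<lambda>x. max (zonal (legendre (k n)) x) 0) /
      Lp_norm p S2_measure (\<lambda>x. max (- zonal (legendre (k n)) x) 0)) \<longlonglongrightarrow> L"
    using lim by (simp add: o_def sign_ratio_def k_def)
  moreover have "L > 1" using a L by simp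
  ultimately show ?thesis
    by (intro exI[of _ "\<lambda>n. zonal (legendre (k n))"] exI[of _ "\<lambda>n. real (k n) * (real (k n) + 1)"]
        exI[of _ L]) blast
qed

end
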